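(* Let $m\ge 1$ be an integer and let $\alpha>m-1$ be real. Then there is $n_0$ such that for all $n\ge n_0$ the set $\{x_1,\dots,x_n\}$ of the regular zeros (the zeros in $(0,\infty)$) of the type II exceptional Laguerre polynomial $L_{m,m+n}^{II,(\alpha)}$ is the unique set of minimal energy with respect to the external field $\left(v_{m,n}^{(\alpha+1)}\right)^{\frac1{2(n-1)}}$ on $(0,\infty)$; that is, the function $$T_v(u_1,\dots,u_n)=\prod_{j=1}^n v(u_j)\prod_{1\le i<j\le n}(u_i-u_j)^2,\qquad v=v_{m,n}^{(\alpha+1)},$$ on $(0,\infty)^n$ attains its maximum exactly at the points $(u_1,\dots,u_n)$ with $\{u_1,\dots,u_n\}=\{x_1,\dots,x_n\}$.
   Context: $L_k^{(a)}$ denotes the classical Laguerre polynomial of degree $k$ with parameter $a$ (defined for all real $a$), satisfying $xy''+(a+1-x)y'+ky=0$. Type II exceptional Laguerre polynomials of codimension $m\ge1$, for $\alpha>m-1$: let $S(x)=L_m^{(-\alpha-1)}(x)$, which has no zeros in $[0,\infty)$. $L_{m,m+n}^{II,(\alpha)}$ ($n\ge 0$) is the real polynomial of degree $m+n$, unique up to a nonzero constant factor (irrelevant here), which satisfies $$y''(x)+\left(\frac{\alpha+1-x}{x}-\frac{2S'(x)}{S(x)}\right)y'(x)+\left(\frac{n-m}{x}+\frac{2S'(x)}{S(x)}\right)y(x)=0 .$$ These polynomials are orthogonal on $(0,\infty)$ with respect to $x^{\alpha}e^{-x}/S(x)^2$. It is known that $L_{m,m+n}^{II,(\alpha)}$ has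 $m+n$ simple zeros: exactly $n$ in $(0,\infty)$ (regular zeros) and $m$ outside $[0,\infty)$ (exceptional zeros, possibly complex; none or one of them is negative real according to whether $m$ is even or odd); as $n\to\infty$ the exceptional zeros converge to the zeros of $S$. Write $L_{m,m+n}^{II,(\alpha)}=P_{m,n}q_{m,n}$, where $q_{m,n}$ is a real polynomial of degree $n$ whose zeros are the regular zeros and $P_{m,n}$ is a real polynomial of degree $m$ whose zeros are the exceptional zeros. Put $$v_{m,n}^{(\alpha+1)}(x)=\frac{x^{\alpha+1}e^{-x}P_{m,n}(x)^2}{S(x)^2},\qquad x\in(0,\infty).$$ *)

theory Defs
  imports
    Complex_Main
    "HOL-Library.FuncSet"
    "HOL-Computational_Algebra.Polynomial"
begin

definition laguerre :: "nat \<Rightarrow> real \<Rightarrow> real poly" where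
  "laguerre k a =
     (\<Sum>i\<le>k. monom ((- 1) ^ i * ((real k + a) gchoose (k - i)) / fact i) i)"

definition laguerre_denom :: "nat \<Rightarrow> real \<Rightarrow> real poly" where
  "laguerre_denom m \<alpha> = laguerre m (- \<alpha> - 1)"

(* Determined by m, n, alpha only up to a nonzero constant factor, hence a predicate. *)
definition exc_laguerre2 :: "nat \<Rightarrow> nat \<Rightarrow> real \<Rightarrow> real poly \<Rightarrow> bool" where
  "exc_laguerre2 m n \<alpha> L \<longleftrightarrow>
     degree L = m + n \<and>
     (let S = laguerre_denom m \<alpha> in
      \<forall>x. x \<noteq> 0 \<longrightarrow> poly S x \<noteq> 0 \<longrightarrow>
        poly (pderiv (pderiv L)) x
        + ((\<alpha> + 1 - x) / x - 2 * poly (pderiv S) x / poly S x) * poly (pderiv L) x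
        + ((real n - real m) / x + 2 * poly (pderiv S) x / poly S x) * poly L x = 0)"

definition regular_zeros :: "real poly \<Rightarrow> real set" where
  "regular_zeros L = {x. 0 < x \<and> poly L x = 0}"

(* The zeros of an exceptional Laguerre polynomial are simple, so the monic
   polynomial with simple zeros at the regular zeros divides it, and the quotient
   has precisely the exceptional zeros. *)
definition regular_factor :: "real poly \<Rightarrow> real poly" where
  "regular_factor L = (\<Prod>x\<in>regular_zeros L. [:- x, 1:])"

definition exceptional_factor :: "real poly \<Rightarrow> real poly" where
  "exceptional_factor L = L div regular_factor L"

definition exc_weight :: "nat \<Rightarrow> real \<Rightarrow> real poly \<Rightarrow> real \<Rightarrow> real" where
  "exc_weight m \<alpha> L x =
     x powr (\<alpha> + 1) * exp (- x) * (poly (exceptional_factor L) x)\<^sup>2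
       / (poly (laguerre_denom m \<alpha>) x)\<^sup>2"

definition weighted_disc :: "(real \<Rightarrow> real) \<Rightarrow> nat \<Rightarrow> (nat \<Rightarrow> real) \<Rightarrow> real" where
  "weighted_disc v n u =
     (\<Prod>j\<in>{1..n}. v (u j)) * (\<Prod>j\<in>{1..n}. \<Prod>i\<in>{1..<j}. (u i - u j)\<^sup>2)"

(* Discrete logarithmic energy in the external field w, written as a positive weight
   (w = exp (- Q)).  If w = v powr (1 / (2 * (n - 1))) with v positive and X consists of
   n points u 1, ..., u n, its value is - ln (weighted_disc v n u). *)
definition field_energy :: "(real \<Rightarrow> real) \<Rightarrow> real set \<Rightarrow> real" where
  "field_energy w X = (\<Sum>x\<in>X. \<Sum>y\<in>X - {x}. ln (1 / (\<bar>x - y\<bar> * w x * w y)))"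

definition minimal_energy_sets :: "(real \<Rightarrow> real) \<Rightarrow> real set \<Rightarrow> nat \<Rightarrow> real set set" where
  "minimal_energy_sets w A n =
     {X. is_arg_min (field_energy w) (\<lambda>X. X \<subseteq> A \<and> finite X \<and> card X = n) X}"

end

theory Submission
  imports
    Defs
    "HOL-Computational_Algebra.Fundamental_Theorem_Algebra"
    "HOL-Complex_Analysis.Great_Picard"
    "HOL-Real_Asymp.Real_Asymp"
begin

text \<open>
  Write \<open>S\<close> for the denominator and \<open>u\<close> for the Laguerre polynomial of degree \<open>n\<close> with parameter
  \<open>\<alpha> + 1\<close>.  Up to a constant the exceptional polynomial is \<open>x (S u' - S' u) + (\<alpha> + 1) S u\<close>.
  Rolle's theorem gives it \<open>n\<close> positive zeros.  Off the half-line \<open>u' / u\<close> tends to infinity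
  locally uniformly, so by Hurwitz's theorem the remaining \<open>m\<close> zeros tend to the zeros of \<open>S\<close>,
  which are simple and off the half-line.  Hence \<open>2 ln \<bar>P / S\<bar>\<close> becomes negligible against the
  strictly concave term \<open>(\<alpha> + 1) ln x\<close> of the logarithm of the weight, and the logarithm of the
  discriminant is strictly concave on ordered configurations.  By the differential equation the
  regular zeros are a critical configuration, so they are the unique maximum.
\<close>

section \<open>Classical Laguerre polynomials\<close>

text \<open>The estimate on \<open>P / S\<close> has to hold on the whole positive half-line at
  once, although the concavity supplied by \<open>(\<alpha> + 1) ln x\<close> fades like
  \<open>1 / x^2\<close>. Resolvents are therefore compared after multiplication by
  \<open>x * y\<close>: the quotient \<open>x / (x - s)\<close> stays bounded for
  \<open>x > 0\<close>. Concavity is expressed by a strictly decreasing first derivative, so divided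
  differences suffice and no second derivative of the weight appears. The growth of
  \<open>u' / u\<close> comes from its Riccati equation at a negative point, with no asymptotic
  formula; the substitution \<open>z = - r^2\<close> carries it to complex points. No fact about the
  zeros is presupposed: \<open>n\<close> positive zeros and \<open>m\<close> zeros close to those of
  \<open>S\<close> exhaust the degree \<open>m + n\<close>, which at once identifies the regular
  zeros and shows that all zeros are simple. Everything is proved for the Darboux transform and
  passes to an arbitrary solution because the differential operator multiplies the top coefficient
  of a polynomial of degree \<open>d\<close> by a nonzero multiple of \<open>m + n - d\<close>, so
  its polynomial kernel is one-dimensional.\<close>

lemma coeff_laguerre: "coeff (laguerre k a) i =
   (if i \<le> k then (- 1) ^ i * ((real k + a) gchoose (k - i)) / fact i else 0)"
  by (simp add: laguerre_def coeff_sum if_distrib cong: if_cong)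

lemma degree_laguerre [simp]: "degree (laguerre k a) = k"
  by (rule antisym) (auto intro!: degree_le le_degree simp: coeff_laguerre)

lemma laguerre_nonzero [simp]: "laguerre k a \<noteq> 0"
proof -
  have "coeff (laguerre k a) k \<noteq> 0" by (simp add: coeff_laguerre)
  then show ?thesis by auto
qed

lemma gbinomial_ratio:
  "(A - real N) * (A gchoose N) = real (Suc N) * (A gchoose (Suc N))"
  by (metis gbinomial_absorb_comp gbinomial_absorption)

text \<open>This is the Laguerre equation read coefficient by coefficient. The multiplied-out form
  stays valid where \<open>real (Suc i) + a\<close> vanishes, which can happen for negative
  parameters.\<close>

lemma coeff_laguerre_Suc:
  "real (Suc i) * (real (Suc i) + a) * coeff (laguerre k a) (Suc i)
     = (real i - real k) * coeff (laguerre k a) i"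
proof (cases "Suc i \<le> k")
  case True
  then obtain N where "k = Suc i + N" using le_Suc_ex by blast
  then have k: "k = Suc (i + N)" by simp
  have "k - Suc i = N" "k - i = Suc N" using k by auto
  have "(real (Suc i) + a) * (real k + a gchoose N) = real (Suc N) * (real k + a gchoose Suc N)"
    using gbinomial_ratio[of "real k + a" N] by (simp add: k algebra_simps)
  note G = this
  have fact: "real (Suc i) * (c / fact (Suc i)) = c / fact i" for c :: real
    by (simp del: of_nat_Suc)
  have "real (Suc i) * (real (Suc i) + a) * coeff (laguerre k a) (Suc i)
      = (real (Suc i) + a) * (real (Suc i) * ((- 1) ^ Suc i * (real k + a gchoose N) / fact (Suc i)))"
    using True \<open>k - Suc i = N\<close> by (simp only: coeff_laguerre if_True mult_ac)
  also have "\<dots> = (- 1) ^ Suc i * ((real (Suc i) + a) * (real k + a gchoose N)) / fact i"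
    unfolding fact by (simp only: mult_ac times_divide_eq_right)
  also have "\<dots> = - real (Suc N) * ((- 1) ^ i * (real k + a gchoose Suc N) / fact i)"
    unfolding G by (simp add: algebra_simps)
  also have "- real (Suc N) = real i - real k" using k by simp
  also have "(- 1) ^ i * (real k + a gchoose Suc N) / fact i = coeff (laguerre k a) i"
    using True \<open>k - i = Suc N\<close> by (simp add: coeff_laguerre)
  finally show ?thesis .
next
  case False
  then show ?thesis by (auto simp: coeff_laguerre)
qed

lemma laguerre_ode:
  fixes a x :: real and k :: nat
  defines "y \<equiv> laguerre k a"
  shows "x * poly (pderiv (pderiv y)) x + (a + 1 - x) * poly (pderiv y) x + real k * poly y x = 0"
proof -
  have "pCons 0 (pderiv (pderiv y)) + [:a + 1, -1:] * pderiv y + smult (real k) y = 0"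
  proof (rule poly_eqI)
    fix i
    show "coeff (pCons 0 (pderiv (pderiv y)) + [:a + 1, -1:] * pderiv y + smult (real k) y) i
            = coeff 0 i"
      using coeff_laguerre_Suc[of i a k]
      by (cases i) (auto simp: y_def coeff_pderiv algebra_simps)
  qed
  then have "poly (pCons 0 (pderiv (pderiv y)) + [:a + 1, -1:] * pderiv y + smult (real k) y) x = 0"
    by simp
  then show ?thesis by (simp add: algebra_simps)
qed

text \<open>One step of the Rodrigues formula: after multiplication by
  \<open>x powr a * exp (- x)\<close> the left-hand side is the derivative of
  \<open>x powr (a + 1) * exp (- x) * y\<close>. This drives the induction on the number of positive
  zeros.\<close>

lemma laguerre_raise:
  fixes a x :: real and k :: nat
  defines "y \<equiv> laguerre k (a + 1)"
  shows "x * poly (pderiv y) x + (a + 1 - x) * poly y x = real (Suc k) * poly (laguerre (Suc k) a) x"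
proof -
  have "pCons 0 (pderiv y) + [:a + 1, -1:] * y = smult (real (Suc k)) (laguerre (Suc k) a)"
  proof (rule poly_eqI)
    fix i
    have *: "(real i + a + 1) * coeff y i - (if i = 0 then 0 else coeff y (i - 1))
            = real (Suc k) * coeff (laguerre (Suc k) a) i"
    proof -
      consider "i \<le> k" | "i = Suc k" | "i > Suc k" by linarith
      then show ?thesis
      proof cases
        case 1
        define A where "A = real k + a + 1"
        have N: "(real i + a + 1) * (A gchoose (k - i)) = real (Suc (k - i)) * (A gchoose Suc (k - i))"
          using gbinomial_ratio[of A "k - i"] 1 by (simp add: A_def of_nat_diff algebra_simps)
        have S: "Suc k - i = Suc (k - i)" using 1 by auto
        have prev: "(if i = 0 then 0 else coeff y (i - 1)) =
            - (real i * ((- 1) ^ i * (A gchoose Suc (k - i)) / fact i))"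
        proof (cases i)
          case (Suc j)
          then have "k - j = Suc (k - i)" using 1 by auto
          moreover have "real i * (c / fact i) = c / fact j" for c :: real
            using Suc by (simp del: of_nat_Suc)
          ultimately show ?thesis using 1 Suc
            by (simp add: y_def coeff_laguerre A_def add_ac del: of_nat_Suc)
        qed simp
        have "(real i + a + 1) * coeff y i = real (Suc (k - i)) * ((- 1) ^ i * (A gchoose Suc (k - i)) / fact i)"
          using N 1 by (simp add: y_def coeff_laguerre A_def add_ac mult_ac)
        moreover have "coeff (laguerre (Suc k) a) i = (- 1) ^ i * (A gchoose Suc (k - i)) / fact i"
          using 1 by (simp add: coeff_laguerre A_def S add_ac)
        ultimately show ?thesis
          unfolding prev using 1 by (simp add: of_nat_diff algebra_simps flip: add_divide_distrib)
      next
        case 2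
        then show ?thesis by (simp add: y_def coeff_laguerre)
      qed (auto simp: y_def coeff_laguerre)
    qed
    show "coeff (pCons 0 (pderiv y) + [:a + 1, -1:] * y) i
            = coeff (smult (real (Suc k)) (laguerre (Suc k) a)) i"
      using * by (cases i) (auto simp: coeff_pderiv algebra_simps)
  qed
  then have "poly (pCons 0 (pderiv y) + [:a + 1, -1:] * y) x
      = poly (smult (real (Suc k)) (laguerre (Suc k) a)) x" by simp
  then show ?thesis by (simp add: algebra_simps)
qed

section \<open>Rolle arguments and the positive zeros of the Laguerre polynomials\<close>

text \<open>Adding the zeros in increasing order, each new zero of \<open>D\<close> lies beyond all
  those found before. Differentiability is asked only in the open interval because the functions
  used contain a real power of \<open>x\<close> and are merely continuous at the left end 0.\<close>

lemma Rolle_finite: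
  fixes f D :: "real \<Rightarrow> real"
  assumes "finite A" "A \<noteq> {}" "\<And>x. x \<in> A \<Longrightarrow> f x = 0"
    and "continuous_on {Min A..Max A} f"
    and "\<And>x. x \<in> {Min A<..<Max A} \<Longrightarrow> (f has_real_derivative D x) (at x)"
  shows "\<exists>B. finite B \<and> Suc (card B) = card A \<and> B \<subseteq> {Min A<..<Max A} \<and> (\<forall>x\<in>B. D x = 0)"
  using assms
proof (induction A rule: finite_linorder_max_induct)
  case (insert b A)
  show ?case
  proof (cases "A = {}")
    case True
    then show ?thesis by (intro exI[of _ "{}"]) auto
  next
    case False
    have Ab: "Max A < b" and MA: "Max A \<in> A" and mA: "Min A \<in> A"
      using insert.hyps False by auto
    have mM: "Min A \<le> Max A" using insert.hyps False by auto
    have mi: "Min (insert b A) = Min A" "Max (insert b A) = b"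
      using insert.hyps False Ab mM by (auto intro!: Min_eqI Max_eqI intro: less_imp_le)
    obtain B where B: "finite B" "Suc (card B) = card A" "B \<subseteq> {Min A<..<Max A}" "\<forall>x\<in>B. D x = 0"
    proof -
      have "continuous_on {Min A..Max A} f"
        using insert.prems(3) unfolding mi by (rule continuous_on_subset) (use Ab in auto)
      moreover have "(f has_real_derivative D x) (at x)" if "x \<in> {Min A<..<Max A}" for x
        using insert.prems(4)[of x] that Ab unfolding mi by auto
      ultimately show ?thesis using insert.IH[OF False] insert.prems(2) that by blast
    qed
    have "\<exists>z>Max A. z < b \<and> (f has_real_derivative 0) (at z)"
    proof (rule Rolle[OF Ab])
      show "f (Max A) = f b" using insert.prems(2) MA by simp
      show "continuous_on {Max A..b} f"
        using insert.prems(3) unfolding mi by (rule continuous_on_subset) (use mM in auto)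
      show "f differentiable (at x)" if "Max A < x" "x < b" for x
        using insert.prems(4)[of x] that mM unfolding mi real_differentiable_def by auto
    qed
    then obtain z where z: "Max A < z" "z < b" "(f has_real_derivative 0) (at z)" by blast
    then have "D z = 0" using insert.prems(4)[of z] mM unfolding mi
      by (auto intro: DERIV_unique)
    moreover have "z \<notin> B" using B z by auto
    moreover have "b \<notin> A" using insert.hyps by auto
    ultimately show ?thesis
      using B z mM insert.hyps unfolding mi
      by (intro exI[of _ "insert z B"]) (auto simp: subset_iff intro: less_trans)
  qed
qed simp

lemma poly_no_zero_imp_strict_sign:
  fixes p :: "real poly"
  assumes "\<And>x. x > b \<Longrightarrow> poly p x \<noteq> 0"
  shows "(\<forall>x>b. poly p x > 0) \<or> (\<forall>x>b. poly p x < 0)"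
proof (rule ccontr)
  assume "\<not> ?thesis"
  then obtain x y where xy: "x > b" "y > b" "poly p x < 0" "poly p y > 0"
    using assms by (meson linorder_neqE_linordered_idom)
  have "\<exists>z>b. poly p z = 0"
  proof (cases x y rule: linorder_cases)
    case less
    then show ?thesis using poly_IVT_pos[of x y p] xy by (meson order_less_trans)
  next
    case greater
    then show ?thesis using poly_IVT_neg[of y x p] xy by (meson order_less_trans)
  qed (use xy in auto)
  then show False using assms by auto
qed

text \<open>Treats infinity as one more zero of \<open>f\<close>. Without a zero of \<open>p\<close>
  the derivative has constant sign, so \<open>f\<close> leaves the value 0 strictly monotonically
  and cannot tend to 0. The factor \<open>h\<close> isolates a polynomial, for which constancy of
  sign follows from the intermediate value theorem.\<close>

lemma Rolle_at_top:
  fixes f h :: "real \<Rightarrow> real" and p :: "real poly"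
  assumes "f b = 0" and cont: "continuous_on {b..} f" and "(f \<longlongrightarrow> 0) at_top"
    and D: "\<And>x. x > b \<Longrightarrow> (f has_real_derivative (h x * poly p x)) (at x)"
    and "\<And>x. x > b \<Longrightarrow> h x > 0"
  shows "\<exists>x>b. poly p x = 0"
proof (rule ccontr)
  assume nz: "\<not> ?thesis"
  have main: False
    if g: "g b = 0" "continuous_on {b..} g" "(g \<longlongrightarrow> 0) at_top"
      and D: "\<And>x. x > b \<Longrightarrow> \<exists>y>0. (g has_real_derivative y) (at x)" for g :: "real \<Rightarrow> real"
  proof -
    have mono: "g x < g y" if "b \<le> x" "x < y" for x y
    proof (rule DERIV_pos_imp_increasing_open[OF that(2)])
      show "\<exists>y. (g has_real_derivative y) (at z) \<and> y > 0" if "x < z" "z < y" for z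
        using D[of z] that \<open>b \<le> x\<close> by auto
      show "continuous_on {x..y} g"
        using g(2) by (rule continuous_on_subset) (use that in auto)
    qed
    have "eventually (\<lambda>x. g (b + 1) \<le> g x) at_top"
      using eventually_gt_at_top[of "b + 1"] by eventually_elim (use mono in \<open>auto intro: less_imp_le\<close>)
    then have "g (b + 1) \<le> 0" using g(3)
      by (intro tendsto_lowerbound[of g 0 at_top]) auto
    then show False using mono[of b "b + 1"] g(1) by auto
  qed
  have "(\<forall>x>b. poly p x > 0) \<or> (\<forall>x>b. poly p x < 0)"
    using nz by (intro poly_no_zero_imp_strict_sign) auto
  then show False
  proof
    assume "\<forall>x>b. poly p x > 0"
    then have "\<exists>y>0. (f has_real_derivative y) (at x)" if "x > b" for x
      using D[OF that] assms(5)[OF that] that by (intro exI[of _ "h x * poly p x"]) auto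
    then show False using assms(1-3) by (intro main[of f]) auto
  next
    assume *: "\<forall>x>b. poly p x < 0"
    have "\<exists>y>0. ((\<lambda>x. - f x) has_real_derivative y) (at x)" if "x > b" for x
      using DERIV_minus[OF D[OF that]] assms(5)[OF that] * that
      by (intro exI[of _ "- (h x * poly p x)"]) (auto simp: mult_pos_neg)
    then show False using assms(1-3) tendsto_minus[OF assms(3)]
      by (intro main[of "\<lambda>x. - f x"]) (auto intro: continuous_on_minus)
  qed
qed

lemma tendsto_powr_exp_poly_at_top:
  "((\<lambda>x. x powr c * exp (- x) * poly p x) \<longlongrightarrow> (0::real)) at_top"
proof -
  have "((\<lambda>x. \<Sum>i\<le>degree p. coeff p i * (x powr (c + real i) * exp (- x))) \<longlongrightarrow> (\<Sum>i\<le>degree p. coeff p i * 0)) at_top"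
    by (intro tendsto_intros) real_asymp
  moreover have "eventually (\<lambda>x. (\<Sum>i\<le>degree p. coeff p i * (x powr (c + real i) * exp (- x))) =
     x powr c * exp (- x) * poly p x) at_top"
    using eventually_gt_at_top[of 0]
    by eventually_elim (simp add: poly_altdef sum_distrib_left powr_add powr_realpow mult_ac)
  ultimately show ?thesis by (simp add: tendsto_cong)
qed

text \<open>Raising the degree lowers the parameter: the weighted polynomial of degree
  \<open>k\<close> with parameter \<open>a + 1\<close> vanishes at 0, at its \<open>k\<close>
  positive zeros and at infinity, so its derivative has \<open>k + 1\<close> zeros.\<close>

lemma laguerre_positive_zeros:
  assumes "a > -1"
  shows "\<exists>A. finite A \<and> card A = k \<and> A \<subseteq> {0<..} \<and> (\<forall>x\<in>A. poly (laguerre k a) x = 0)"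
  using assms
proof (induction k arbitrary: a)
  case (Suc k)
  obtain A where A: "finite A" "card A = k" "A \<subseteq> {0<..}" "\<forall>x\<in>A. poly (laguerre k (a + 1)) x = 0"
    using Suc.IH[of "a + 1"] Suc.prems by auto
  \<comment> \<open>Since \<open>0 powr (a + 1) = 0\<close>, the function \<open>f\<close> also
    vanishes at 0; its continuity there rests on \<open>a > -1\<close>.\<close>
  define A0 where "A0 = insert 0 A"
  define f where "f = (\<lambda>x. x powr (a + 1) * exp (- x) * poly (laguerre k (a + 1)) x)"
  define h where "h = (\<lambda>x::real. x powr a * exp (- x) * real (Suc k))"
  have A0: "finite A0" "A0 \<noteq> {}" "card A0 = Suc k" "Min A0 = 0" "Max A0 \<ge> 0"
    using A by (auto simp: A0_def card_insert_if intro!: Min_eqI)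
  have f0: "f x = 0" if "x \<in> A0" for x using that A by (auto simp: A0_def f_def)
  have cont: "continuous_on {0..} f"
    unfolding f_def using Suc.prems
    by (intro continuous_intros continuous_on_powr') auto
  have D: "(f has_real_derivative (h x * poly (laguerre (Suc k) a) x)) (at x)" if "x > 0" for x
  proof -
    have "x powr (a + 1) = x * x powr a" using that by (simp add: powr_add)
    then have eq: "(a + 1) * x powr a * exp (- x) * poly (laguerre k (a + 1)) x
        - x powr (a + 1) * exp (- x) * poly (laguerre k (a + 1)) x
        + x powr (a + 1) * exp (- x) * poly (pderiv (laguerre k (a + 1))) x
        = x powr a * exp (- x) * (x * poly (pderiv (laguerre k (a + 1))) x
            + (a + 1 - x) * poly (laguerre k (a + 1)) x)"
      by (simp add: algebra_simps)
    have "(f has_real_derivative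
       ((a + 1) * x powr a * exp (- x) * poly (laguerre k (a + 1)) x
        - x powr (a + 1) * exp (- x) * poly (laguerre k (a + 1)) x
        + x powr (a + 1) * exp (- x) * poly (pderiv (laguerre k (a + 1))) x)) (at x)"
      unfolding f_def using that
      by (auto intro!: derivative_eq_intros poly_DERIV simp: algebra_simps)
    then show ?thesis
      unfolding eq laguerre_raise h_def by (simp add: mult.assoc)
  qed
  obtain B where B: "finite B" "Suc (card B) = card A0" "B \<subseteq> {Min A0<..<Max A0}"
    "\<forall>x\<in>B. h x * poly (laguerre (Suc k) a) x = 0"
  proof -
    have "continuous_on {Min A0..Max A0} f"
      using cont by (rule continuous_on_subset) (use A0 in auto)
    moreover have "(f has_real_derivative h x * poly (laguerre (Suc k) a) x) (at x)"
      if "x \<in> {Min A0<..<Max A0}" for x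
      using D[of x] that A0(4) by auto
    ultimately show ?thesis
      using Rolle_finite[OF A0(1,2), of f "\<lambda>x. h x * poly (laguerre (Suc k) a) x"] f0 that by blast
  qed
  have hp: "h x > 0" if "x > 0" for x using that by (simp add: h_def)
  have "\<exists>x>Max A0. poly (laguerre (Suc k) a) x = 0"
  proof (rule Rolle_at_top[of f "Max A0" h])
    show "f (Max A0) = 0" using A0 f0 by auto
    show "continuous_on {Max A0..} f" using cont by (rule continuous_on_subset) (use A0 in auto)
    show "(f \<longlongrightarrow> 0) at_top" unfolding f_def by (rule tendsto_powr_exp_poly_at_top)
    show "(f has_real_derivative h x * poly (laguerre (Suc k) a) x) (at x)" "h x > 0"
      if "x > Max A0" for x using D[of x] hp[of x] that A0(5) by linarith+
  qed
  then obtain z where z: "z > Max A0" "poly (laguerre (Suc k) a) z = 0" by blast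
  have "z \<notin> B" using B z by auto
  moreover have "z > 0" using z A0(5) by linarith
  moreover have "x > 0 \<and> poly (laguerre (Suc k) a) x = 0" if "x \<in> B" for x
  proof -
    have "x > 0" using B(3) that A0(4) by auto
    then show ?thesis using B(4) hp[of x] that by auto
  qed
  ultimately show ?case using B(1,2) z A0(3)
    by (intro exI[of _ "insert z B"]) auto
qed (intro exI[of _ "{}"], auto)

section \<open>The exceptional polynomials\<close>

lemma laguerre_denom_ode:
  "x * poly (pderiv (pderiv (laguerre_denom m \<alpha>))) x
     = (\<alpha> + x) * poly (pderiv (laguerre_denom m \<alpha>)) x - real m * poly (laguerre_denom m \<alpha>) x"
  using laguerre_ode[of x m "- \<alpha> - 1"] by (simp add: laguerre_denom_def algebra_simps)

lemma degree_laguerre_denom [simp]: "degree (laguerre_denom m \<alpha>) = m"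
  by (simp add: laguerre_denom_def)

lemma laguerre_denom_nonzero [simp]: "laguerre_denom m \<alpha> \<noteq> 0"
  by (simp add: laguerre_denom_def)

lemma gbinomial_neg_sign:
  assumes "A < 0" shows "(-1) ^ k * (A gchoose k) > (0::real)"
proof (induction k)
  case (Suc k)
  have "real (Suc k) * ((-1) ^ Suc k * (A gchoose Suc k)) = (real k - A) * ((-1) ^ k * (A gchoose k))"
    by (simp only: power_Suc mult.left_commute[of "real (Suc k)"] gbinomial_ratio[symmetric])
      (simp add: algebra_simps)
  also have "\<dots> > 0" by (rule mult_pos_pos) (use assms Suc.IH in simp_all)
  finally show ?case by (rule zero_less_mult_pos) simp
qed simp

text \<open>All coefficients have the sign of \<open>(-1) ^ m\<close>: the upper entry
  \<open>real m - \<alpha> - 1\<close> of the binomials is negative, so they alternate with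
  \<open>m - i\<close> and cancel the alternation \<open>(-1) ^ i\<close>.\<close>

lemma laguerre_denom_nonneg_nonzero:
  assumes "\<alpha> > real m - 1" "x \<ge> 0"
  shows "poly (laguerre_denom m \<alpha>) x \<noteq> 0"
proof -
  have c: "(-1) ^ m * coeff (laguerre_denom m \<alpha>) i > 0" if "i \<le> m" for i
  proof -
    have "(-1::real) ^ m = (-1) ^ i * (-1) ^ (m - i)" using that by (simp flip: power_add)
    then have "(-1) ^ m * coeff (laguerre_denom m \<alpha>) i
        = ((-1) ^ i * (-1) ^ i) * ((-1) ^ (m - i) * (real m - \<alpha> - 1 gchoose (m - i))) / fact i"
      using that by (simp add: laguerre_denom_def coeff_laguerre algebra_simps)
    also have "(-1::real) ^ i * (-1) ^ i = 1" by (simp flip: power_mult_distrib)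
    also have "1 * ((-1) ^ (m - i) * (real m - \<alpha> - 1 gchoose (m - i))) / fact i > 0"
      using gbinomial_neg_sign[of "real m - \<alpha> - 1" "m - i"] assms by simp
    finally show ?thesis .
  qed
  have "0 < (\<Sum>i\<in>{0}. ((-1) ^ m * coeff (laguerre_denom m \<alpha>) i) * x ^ i)"
    using c[of 0] by (simp del: zero_less_mult_iff zero_less_power_eq)
  also have "\<dots> \<le> (\<Sum>i\<le>m. ((-1) ^ m * coeff (laguerre_denom m \<alpha>) i) * x ^ i)"
    by (rule sum_mono2) (use assms less_imp_le[OF c] in \<open>auto intro!: mult_nonneg_nonneg\<close>)
  also have "\<dots> = (-1) ^ m * poly (laguerre_denom m \<alpha>) x"
    by (simp add: poly_altdef sum_distrib_left mult.assoc)
  finally show ?thesis by auto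
qed

section \<open>The exceptional equation as a polynomial identity, its solution and
  uniqueness\<close>

lemma coeff_mult_le:
  assumes "degree p \<le> i" "degree q \<le> j"
  shows "coeff (p * q) (i + j) = coeff p i * coeff q j"
proof (cases "degree p = i \<and> degree q = j")
  case True
  then show ?thesis using coeff_mult_degree_sum[of p q] by simp
next
  case False
  then have "degree p + degree q < i + j" "coeff p i = 0 \<or> coeff q j = 0"
    using assms by (auto simp: coeff_eq_0)
  then show ?thesis
    using degree_mult_le[of p q] by (auto simp: coeff_eq_0)
qed

lemma coeff_pCons_pderiv: "coeff (pCons 0 (pderiv p)) i = of_nat i * coeff p i"
  by (cases i) (auto simp: coeff_pderiv)

lemma degree_pCons_pderiv_le: "degree (pCons 0 (pderiv p)) \<le> degree p"
  by (rule degree_le) (auto simp: coeff_pCons_pderiv coeff_eq_0)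

text \<open>The left-hand side of the defining equation of the exceptional polynomials, multiplied
  by \<open>x S(x)\<close>.\<close>

definition exc_op :: "nat \<Rightarrow> nat \<Rightarrow> real \<Rightarrow> real poly \<Rightarrow> real poly" where
  "exc_op m n \<alpha> y = (let S = laguerre_denom m \<alpha> in
     S * pCons 0 (pderiv (pderiv y)) + smult (\<alpha> + 1) (S * pderiv y) - S * pCons 0 (pderiv y)
     - smult 2 (pCons 0 (pderiv S) * pderiv y)
     + smult (real n - real m) (S * y) + smult 2 (pCons 0 (pderiv S) * y))"

lemma poly_exc_op:
  "poly (exc_op m n \<alpha> y) x = (let S = laguerre_denom m \<alpha> in
     x * poly S x * poly (pderiv (pderiv y)) x
     + ((\<alpha> + 1 - x) * poly S x - 2 * x * poly (pderiv S) x) * poly (pderiv y) x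
     + ((real n - real m) * poly S x + 2 * x * poly (pderiv S) x) * poly y x)"
  by (simp add: exc_op_def Let_def algebra_simps)

lemma exc_op_smult_diff:
  "exc_op m n \<alpha> (smult a p - smult b q) = smult a (exc_op m n \<alpha> p) - smult b (exc_op m n \<alpha> q)"
proof -
  have "poly (exc_op m n \<alpha> (smult a p - smult b q)) x
      = poly (smult a (exc_op m n \<alpha> p) - smult b (exc_op m n \<alpha> q)) x" for x
    by (simp add: poly_exc_op Let_def pderiv_diff pderiv_smult algebra_simps)
  then show ?thesis using poly_eq_poly_eq_iff by blast
qed

text \<open>Removes the exceptions at 0 and at the zeros of \<open>S\<close>: the polynomial
  \<open>x * S * exc_op\<close> vanishes at every real point, hence is zero, and the factor
  \<open>x * S\<close> can be cancelled. Afterwards the equation may be used at any point.\<close>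

lemma exc_laguerre2_iff:
  "exc_laguerre2 m n \<alpha> L \<longleftrightarrow> degree L = m + n \<and> exc_op m n \<alpha> L = 0"
proof -
  define S where "S = laguerre_denom m \<alpha>"
  have clear: "poly (exc_op m n \<alpha> L) x = x * poly S x *
      (poly (pderiv (pderiv L)) x
        + ((\<alpha> + 1 - x) / x - 2 * poly (pderiv S) x / poly S x) * poly (pderiv L) x
        + ((real n - real m) / x + 2 * poly (pderiv S) x / poly S x) * poly L x)"
    if "x \<noteq> 0" "poly S x \<noteq> 0" for x
    using that by (simp add: poly_exc_op S_def Let_def field_simps)
  have "exc_op m n \<alpha> L = 0"
    if "\<forall>x. x \<noteq> 0 \<longrightarrow> poly S x \<noteq> 0 \<longrightarrow> poly (exc_op m n \<alpha> L) x = 0"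
  proof -
    have "poly (pCons 0 S * exc_op m n \<alpha> L) x = 0" for x using that by (cases "x = 0 \<or> poly S x = 0") auto
    then have "pCons 0 S * exc_op m n \<alpha> L = 0" using poly_all_0_iff_0 by blast
    then show ?thesis by (auto simp: S_def)
  qed
  then show ?thesis
    unfolding exc_laguerre2_def Let_def S_def[symmetric]
    using clear by (metis mult_eq_0_iff poly_0)
qed

text \<open>With \<open>d = degree y\<close>, the coefficient of
  \<open>exc_op m n \<alpha> y\<close> at \<open>m + d\<close> is the product of the two leading
  coefficients and \<open>m + n - d\<close>; the terms with \<open>y''\<close> and those with
  \<open>y'\<close> not multiplied by \<open>x\<close> do not reach this degree.\<close>

lemma exc_op_degree:
  assumes "exc_op m n \<alpha> y = 0" "y \<noteq> 0"
  shows "degree y = m + n"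
proof -
  define S where "S = laguerre_denom m \<alpha>"
  define d where "d = degree y"
  have S: "degree S = m" "S \<noteq> 0" by (simp_all add: S_def)
  have y: "degree y \<le> d" "degree (pderiv y) \<le> d" "degree (pCons 0 (pderiv y)) \<le> d"
    "degree (pCons 0 (pderiv (pderiv y))) \<le> d" "degree (pCons 0 (pderiv S)) \<le> m"
    using degree_pCons_pderiv_le[of y] degree_pCons_pderiv_le[of "pderiv y"]
      degree_pCons_pderiv_le[of S] degree_pderiv[of y]
    by (auto simp: d_def S(1))
  have "coeff (pderiv y) d = 0" by (simp add: coeff_pderiv d_def coeff_eq_0)
  moreover have "coeff (exc_op m n \<alpha> y) (m + d) = 0" using assms by simp
  ultimately have "coeff S m * coeff y d * (real n - real m - real d + 2 * real m) = 0"
    unfolding exc_op_def Let_def S_def[symmetric] coeff_add coeff_diff coeff_smult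
      coeff_mult_le[OF eq_refl[OF S(1)] y(1)] coeff_mult_le[OF eq_refl[OF S(1)] y(2)]
      coeff_mult_le[OF eq_refl[OF S(1)] y(3)] coeff_mult_le[OF eq_refl[OF S(1)] y(4)]
      coeff_mult_le[OF y(5) y(1)] coeff_mult_le[OF y(5) y(2)] coeff_pCons_pderiv
    by (simp add: algebra_simps)
  moreover have "coeff S m \<noteq> 0" "coeff y d \<noteq> 0" using S assms unfolding d_def by auto
  ultimately show ?thesis unfolding d_def by simp
qed

text \<open>The Darboux transform \<open>x powr (- \<alpha>) * S\<^sup>2 * (x powr (\<alpha> + 1) * u / S)'\<close> of a classical Laguerre polynomial \<open>u\<close>.\<close>

definition exc_darboux :: "nat \<Rightarrow> nat \<Rightarrow> real \<Rightarrow> real poly" where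
  "exc_darboux m n \<alpha> = (let S = laguerre_denom m \<alpha>; u = laguerre n (\<alpha> + 1) in
     S * pCons 0 (pderiv u) - pCons 0 (pderiv S) * u + smult (\<alpha> + 1) (S * u))"

lemma poly_exc_darboux:
  "poly (exc_darboux m n \<alpha>) x = (let S = laguerre_denom m \<alpha>; u = laguerre n (\<alpha> + 1) in
     x * (poly S x * poly (pderiv u) x - poly (pderiv S) x * poly u x)
     + (\<alpha> + 1) * poly S x * poly u x)"
  by (simp add: exc_darboux_def Let_def algebra_simps)

lemma exc_darboux_exc_laguerre2:
  assumes "\<alpha> > real m - 1"
  shows "exc_laguerre2 m n \<alpha> (exc_darboux m n \<alpha>)"
proof -
  define S where "S = laguerre_denom m \<alpha>"
  define u where "u = laguerre n (\<alpha> + 1)"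
  define L where "L = exc_darboux m n \<alpha>"
  have S: "degree S = m" "S \<noteq> 0" and u: "degree u = n" "u \<noteq> 0" by (simp_all add: S_def u_def)
  have S2: "x * poly (pderiv (pderiv S)) x = (\<alpha> + x) * poly (pderiv S) x - real m * poly S x" for x
    unfolding S_def by (rule laguerre_denom_ode)
  have u2: "x * poly (pderiv (pderiv u)) x = - (\<alpha> + 2 - x) * poly (pderiv u) x - real n * poly u x" for x
    using laguerre_ode[of x n "\<alpha> + 1"] unfolding u_def by (simp add: algebra_simps)
  have L: "L = S * pCons 0 (pderiv u) - pCons 0 (pderiv S) * u + smult (\<alpha> + 1) (S * u)"
    by (simp only: L_def exc_darboux_def S_def u_def Let_def)
  \<comment> \<open>Eliminating \<open>u''\<close> and \<open>S''\<close> by their equations shows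
    that \<open>L'\<close> has the shape of \<open>L\<close> with \<open>\<alpha> + 1\<close>
    replaced by \<open>m - n\<close>. The second derivative is therefore found by the same
    computation.\<close>
  have "poly (pderiv L) x = poly (S * pCons 0 (pderiv u) - pCons 0 (pderiv S) * u
      + smult (real m - real n) (S * u)) x" for x
  proof -
    have "poly (pderiv L) x = poly S x * (x * poly (pderiv (pderiv u)) x)
        - poly u x * (x * poly (pderiv (pderiv S)) x)
        + poly S x * poly (pderiv u) x - poly (pderiv S) x * poly u x
        + (\<alpha> + 1) * (poly S x * poly (pderiv u) x + poly (pderiv S) x * poly u x)"
      unfolding L
      by (simp add: pderiv_add pderiv_diff pderiv_mult pderiv_smult pderiv_pCons algebra_simps)
    also have "\<dots> = poly (S * pCons 0 (pderiv u) - pCons 0 (pderiv S) * u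
      + smult (real m - real n) (S * u)) x"
      unfolding S2 u2 by (simp add: algebra_simps)
    finally show ?thesis .
  qed
  then have L': "pderiv L = S * pCons 0 (pderiv u) - pCons 0 (pderiv S) * u
      + smult (real m - real n) (S * u)"
    using poly_eq_poly_eq_iff by blast
  have L'': "poly (pderiv (pderiv L)) x = poly S x * (x * poly (pderiv (pderiv u)) x)
        - poly u x * (x * poly (pderiv (pderiv S)) x)
        + poly S x * poly (pderiv u) x - poly (pderiv S) x * poly u x
        + (real m - real n) * (poly S x * poly (pderiv u) x + poly (pderiv S) x * poly u x)" for x
    unfolding L'
    by (simp add: pderiv_add pderiv_diff pderiv_mult pderiv_smult pderiv_pCons algebra_simps)
  have "poly (exc_op m n \<alpha> L) x = 0" for x
    unfolding poly_exc_op S_def[symmetric] Let_def L'' S2 u2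
    unfolding L' unfolding L by (simp add: algebra_simps)
  then have "exc_op m n \<alpha> L = 0" using poly_all_0_iff_0 by blast
  moreover have "degree L = m + n"
  proof (rule antisym)
    have "degree (S * pCons 0 (pderiv u)) \<le> m + n" "degree (pCons 0 (pderiv S) * u) \<le> m + n"
      "degree (smult (\<alpha> + 1) (S * u)) \<le> m + n"
      using degree_mult_le[of S "pCons 0 (pderiv u)"] degree_mult_le[of "pCons 0 (pderiv S)" u]
        degree_mult_le[of S u] degree_pCons_pderiv_le[of u] degree_pCons_pderiv_le[of S]
        degree_smult_le[of "\<alpha> + 1" "S * u"] S u by linarith+
    then show "degree L \<le> m + n"
      unfolding L by (intro degree_add_le degree_diff_le)
    \<comment> \<open>The three summands contribute \<open>n\<close>, \<open>- m\<close> and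
      \<open>\<alpha> + 1\<close>; the bound \<open>\<alpha> > m - 1\<close> makes their sum
      positive, so the degree does not drop.\<close>
    have "coeff L (m + n) = coeff S m * coeff u n * (real n + (\<alpha> + 1 - real m))"
    proof -
      have "degree (pCons 0 (pderiv u)) \<le> n" "degree (pCons 0 (pderiv S)) \<le> m"
        using S u degree_pCons_pderiv_le[of u] degree_pCons_pderiv_le[of S] by auto
      note c = coeff_mult_le[OF eq_refl[OF S(1)] this(1)] coeff_mult_le[OF this(2) eq_refl[OF u(1)]]
        coeff_mult_le[OF eq_refl[OF S(1)] eq_refl[OF u(1)]]
      show ?thesis
        unfolding L coeff_add coeff_diff coeff_smult c coeff_pCons_pderiv
        by (simp add: algebra_simps)
    qed
    also have "\<dots> \<noteq> 0" using S u assms by (auto simp flip: S(1) u(1))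
    finally show "m + n \<le> degree L" by (rule le_degree)
  qed
  ultimately show ?thesis by (simp add: exc_laguerre2_iff L_def)
qed

text \<open>The combination of two solutions that cancels the leading terms is again annihilated by
  the operator but has no coefficient at \<open>m + n\<close>, so \<open>exc_op_degree\<close>
  forces it to vanish. The assumption \<open>m + n > 0\<close> excludes the zero polynomial, whose
  \<open>degree\<close> is 0.\<close>

lemma exc_laguerre2_unique:
  assumes "exc_laguerre2 m n \<alpha> L" "m + n > 0" "\<alpha> > real m - 1"
  shows "\<exists>c. c \<noteq> 0 \<and> L = smult c (exc_darboux m n \<alpha>)"
proof -
  define M where "M = exc_darboux m n \<alpha>"
  have M: "exc_laguerre2 m n \<alpha> M" unfolding M_def using assms(3) by (rule exc_darboux_exc_laguerre2)
  have "L \<noteq> 0" "M \<noteq> 0" using assms M by (auto simp: exc_laguerre2_iff)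
  then have nz: "lead_coeff L \<noteq> 0" "lead_coeff M \<noteq> 0" by auto
  define y where "y = smult (lead_coeff M) L - smult (lead_coeff L) M"
  have "exc_op m n \<alpha> y = 0" unfolding y_def exc_op_smult_diff
    using assms M by (simp add: exc_laguerre2_iff)
  moreover have "coeff y (m + n) = 0"
    using assms(1) M by (simp add: y_def exc_laguerre2_iff)
  ultimately have "y = 0" using exc_op_degree[of m n \<alpha> y] by (metis leading_coeff_0_iff)
  then have "smult (lead_coeff M) L = smult (lead_coeff L) M" by (simp add: y_def)
  then have "L = smult (lead_coeff L / lead_coeff M) M"
    using nz by (metis divide_inverse mult.commute smult_smult left_inverse smult_1_left)
  then show ?thesis using nz M_def by (intro exI[of _ "lead_coeff L / lead_coeff M"]) auto
qed

text \<open>The function \<open>x powr (\<alpha> + 1) * u / S\<close> vanishes at 0 and at the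
  \<open>n\<close> positive zeros of \<open>u\<close>, and its derivative is
  \<open>exc_darboux\<close> times the positive factor \<open>x powr \<alpha> / S^2\<close>.\<close>

lemma exc_darboux_positive_zeros:
  assumes "\<alpha> > real m - 1" "m \<ge> 1"
  shows "\<exists>B. finite B \<and> card B = n \<and> B \<subseteq> {0<..} \<and> (\<forall>x\<in>B. poly (exc_darboux m n \<alpha>) x = 0)"
proof -
  define S where "S = laguerre_denom m \<alpha>"
  define u where "u = laguerre n (\<alpha> + 1)"
  have \<alpha>: "\<alpha> > 0" using assms by linarith
  obtain A where A: "finite A" "card A = n" "A \<subseteq> {0<..}" "\<forall>x\<in>A. poly u x = 0"
    using laguerre_positive_zeros[of "\<alpha> + 1" n] \<alpha> unfolding u_def by auto
  define A0 where "A0 = insert 0 A"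
  have A0: "finite A0" "A0 \<noteq> {}" "card A0 = Suc n" "Min A0 = 0"
    using A by (auto simp: A0_def card_insert_if intro!: Min_eqI)
  have S: "poly S x \<noteq> 0" if "x \<ge> 0" for x
    unfolding S_def using assms(1) that by (rule laguerre_denom_nonneg_nonzero)
  define f where "f = (\<lambda>x. x powr (\<alpha> + 1) * poly u x / poly S x)"
  define h where "h = (\<lambda>x. x powr \<alpha> / (poly S x)\<^sup>2)"
  have D: "(f has_real_derivative (h x * poly (exc_darboux m n \<alpha>) x)) (at x)" if "x > 0" for x
  proof -
    have *: "x powr (\<alpha> + 1) = x * x powr \<alpha>" using that by (simp add: powr_add)
    have "(f has_real_derivative
        (((\<alpha> + 1) * x powr \<alpha> * poly u x + x powr (\<alpha> + 1) * poly (pderiv u) x) * poly S x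
         - x powr (\<alpha> + 1) * poly u x * poly (pderiv S) x) / (poly S x)\<^sup>2) (at x)"
      unfolding f_def using that S[of x]
      by (auto intro!: derivative_eq_intros poly_DERIV simp: power2_eq_square algebra_simps)
    also have "((\<alpha> + 1) * x powr \<alpha> * poly u x + x powr (\<alpha> + 1) * poly (pderiv u) x) * poly S x
         - x powr (\<alpha> + 1) * poly u x * poly (pderiv S) x
         = x powr \<alpha> * poly (exc_darboux m n \<alpha>) x"
      unfolding poly_exc_darboux S_def[symmetric] u_def[symmetric] Let_def *
      by (simp add: algebra_simps)
    also have "x powr \<alpha> * poly (exc_darboux m n \<alpha>) x / (poly S x)\<^sup>2
         = h x * poly (exc_darboux m n \<alpha>) x"
      by (simp add: h_def)
    finally show ?thesis .
  qed
  have "continuous_on {0..} f" unfolding f_def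
    using \<alpha> S by (intro continuous_intros continuous_on_powr') auto
  then have "continuous_on {Min A0..Max A0} f" by (rule continuous_on_subset) (use A0 in auto)
  moreover have "(f has_real_derivative h x * poly (exc_darboux m n \<alpha>) x) (at x)"
    if "x \<in> {Min A0<..<Max A0}" for x
    using D[of x] that A0(4) by auto
  moreover have "f x = 0" if "x \<in> A0" for x using that A by (auto simp: A0_def f_def)
  ultimately obtain B where B: "finite B" "Suc (card B) = card A0" "B \<subseteq> {Min A0<..<Max A0}"
    "\<forall>x\<in>B. h x * poly (exc_darboux m n \<alpha>) x = 0"
    using Rolle_finite[OF A0(1,2), of f "\<lambda>x. h x * poly (exc_darboux m n \<alpha>) x"] by blast
  have "x > 0 \<and> poly (exc_darboux m n \<alpha>) x = 0" if "x \<in> B" for x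
  proof -
    have "x > 0" using B(3) that A0(4) by auto
    then show ?thesis using B(4) S[of x] that by (auto simp: h_def)
  qed
  then show ?thesis using B A0 by (intro exI[of _ B]) auto
qed

section \<open>Growth of the logarithmic derivative off the half-line\<close>

abbreviation cpoly :: "real poly \<Rightarrow> complex poly" where
  "cpoly \<equiv> map_poly complex_of_real"

lemma cpoly_add: "cpoly (p + q) = cpoly p + cpoly q"
  by (rule poly_eqI) (simp add: coeff_map_poly)

lemma cpoly_diff: "cpoly (p - q) = cpoly p - cpoly q"
  by (rule poly_eqI) (simp add: coeff_map_poly)

lemma cpoly_smult: "cpoly (smult c p) = smult (of_real c) (cpoly p)"
  by (rule map_poly_smult) auto

lemma cpoly_pCons: "cpoly (pCons c p) = pCons (of_real c) (cpoly p)"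
  by (rule map_poly_pCons) auto

lemma cpoly_mult: "cpoly (p * q) = cpoly p * cpoly q"
  by (rule poly_eqI) (simp add: coeff_map_poly coeff_mult)

lemma cpoly_pderiv: "cpoly (pderiv p) = pderiv (cpoly p)"
  by (rule poly_eqI) (simp add: coeff_map_poly coeff_pderiv)

lemma cpoly_prod: "cpoly (prod f A) = (\<Prod>x\<in>A. cpoly (f x))"
  by (induction A rule: infinite_finite_induct) (auto simp: cpoly_mult map_poly_pCons)

lemma degree_cpoly [simp]: "degree (cpoly p) = degree p"
  by (rule degree_map_poly) auto

lemma poly_cpoly [simp]: "poly (cpoly p) (of_real x) = of_real (poly p x)"
  by (induction p) (auto simp: cpoly_pCons)

lemma cpoly_eq_0_iff [simp]: "cpoly p = 0 \<longleftrightarrow> p = 0"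
  by (auto simp: poly_eq_iff coeff_map_poly)

lemma poly_eq_prod_roots:
  fixes p :: "'a :: field poly"
  assumes "finite A" "card A = degree p" "\<And>x. x \<in> A \<Longrightarrow> poly p x = 0"
  shows "p = smult (lead_coeff p) (\<Prod>x\<in>A. [:- x, 1:])"
proof (rule poly_eqI_degree_lead_coeff[where n = "degree p" and A = A])
  have d: "degree (\<Prod>x\<in>A. [:- x, 1:]) = degree p"
    using assms by (subst degree_prod_eq_sum_degree) auto
  have "lead_coeff (\<Prod>x\<in>A. [:- x, 1:]) = 1"
    by (subst lead_coeff_prod) auto
  then show "coeff p (degree p) = coeff (smult (lead_coeff p) (\<Prod>x\<in>A. [:- x, 1:])) (degree p)"
    using d by simp
  show "degree (smult (lead_coeff p) (\<Prod>x\<in>A. [:- x, 1:])) \<le> degree p"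
    using d degree_smult_le le_trans by metis
qed (use assms in \<open>auto simp: poly_prod prod_zero_iff\<close>)

lemma poly_pderiv_prod_linear:
  fixes c :: "'a :: field"
  defines "p \<equiv> \<lambda>A. smult c (\<Prod>x\<in>A. [:- x, 1:])"
  assumes "finite A" "z \<notin> A"
  shows "poly (pderiv (p A)) z = poly (p A) z * (\<Sum>x\<in>A. 1 / (z - x))"
  using assms(2,3)
proof (induction A rule: finite_induct)
  case (insert b A)
  have eq: "p (insert b A) = [:- b, 1:] * p A"
    using insert by (simp add: p_def)
  have "poly (pderiv (p (insert b A))) z = poly (p A) z + (z - b) * poly (pderiv (p A)) z"
    unfolding eq pderiv_mult by (simp add: pderiv_pCons algebra_simps)
  also have "\<dots> = (z - b) * poly (p A) z * (1 / (z - b) + (\<Sum>x\<in>A. 1 / (z - x)))"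
    using insert by (simp add: distrib_left)
  also have "(z - b) * poly (p A) z = poly (p (insert b A)) z"
    unfolding eq by (simp add: algebra_simps)
  finally show ?case using insert by simp
qed (simp add: p_def)

text \<open>At a multiple zero the equation expresses \<open>x S''\<close> by \<open>S'\<close> and
  \<open>S\<close>, which both vanish there to higher order than \<open>S''\<close>. The factor
  \<open>x\<close> cannot make up for this, because zeros of \<open>S\<close> lie off the half-line
  and so differ from 0.\<close>

lemma laguerre_denom_complex_roots:
  assumes "\<alpha> > real m - 1"
  defines "p \<equiv> cpoly (laguerre_denom m \<alpha>)"
  shows "card {z. poly p z = 0} = m" "poly p z = 0 \<Longrightarrow> z \<notin> \<real>\<^sub>\<ge>\<^sub>0"
proof -
  show notin: "z \<notin> \<real>\<^sub>\<ge>\<^sub>0" if "poly p z = 0" for z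
    using that assms laguerre_denom_nonneg_nonzero[of m \<alpha>]
    by (auto simp: nonneg_Reals_def p_def)
  define S where "S = laguerre_denom m \<alpha>"
  have "poly (pCons 0 (pderiv (pderiv S))) x = poly ([:\<alpha>, 1:] * pderiv S - smult (real m) S) x" for x
    using laguerre_denom_ode[of x m \<alpha>] unfolding S_def by (simp add: algebra_simps)
  then have "pCons 0 (pderiv (pderiv S)) = [:\<alpha>, 1:] * pderiv S - smult (real m) S"
    using poly_eq_poly_eq_iff by blast
  then have "cpoly (pCons 0 (pderiv (pderiv S))) = cpoly ([:\<alpha>, 1:] * pderiv S - smult (real m) S)"
    by simp
  then have ode: "[:0, 1:] * pderiv (pderiv p) = [:of_real \<alpha>, 1:] * pderiv p - smult (of_nat m) p"
    unfolding p_def S_def by (simp add: cpoly_mult cpoly_diff cpoly_add cpoly_smult cpoly_pCons cpoly_pderiv)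
  have p0: "p \<noteq> 0" by (simp add: p_def)
  have "rsquarefree p"
    unfolding rsquarefree_roots
  proof safe
    fix a assume a: "poly p a = 0" "poly (pderiv p) a = 0"
    have "a \<noteq> 0" using notin[OF a(1)] by auto
    have pderiv_nz: "pderiv q \<noteq> 0" if "q \<noteq> 0" "poly q a = 0" for q :: "complex poly"
    proof
      assume "pderiv q = 0"
      then obtain c where "q = [:c:]" by (auto simp: pderiv_eq_0_iff elim: degree_eq_zeroE)
      then show False using that by simp
    qed
    have p'0: "pderiv p \<noteq> 0" using pderiv_nz[OF p0 a(1)] .
    have p''0: "pderiv (pderiv p) \<noteq> 0" using pderiv_nz[OF p'0 a(2)] .
    define k where "k = order a (pderiv (pderiv p))"
    have o: "order a (pderiv p) = Suc k" "order a p = Suc (Suc k)"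
      using order_pderiv[OF p0 a(1)] order_pderiv[OF p'0 a(2)] by (auto simp: k_def)
    have "[:- a, 1:] ^ Suc k dvd pderiv p" "[:- a, 1:] ^ Suc k dvd p"
      by (subst order_divides, simp add: o)+
    then have "[:- a, 1:] ^ Suc k dvd [:0, 1:] * pderiv (pderiv p)"
      unfolding ode by (intro dvd_diff dvd_mult dvd_smult)
    then have "Suc k \<le> order a ([:0, 1:] * pderiv (pderiv p))"
      using p''0 by (subst (asm) order_divides) auto
    also have "\<dots> = order a [:0, 1:] + k"
      using p''0 unfolding k_def by (intro order_mult) auto
    also have "order a [:0, 1:] = 0"
      using \<open>a \<noteq> 0\<close> by (intro order_0I) auto
    finally show False by simp
  qed
  then have "smult (lead_coeff p) (\<Prod>z|poly p z = 0. [:- z, 1:]) = p"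
    by (rule complex_poly_decompose_rsquarefree)
  then have "degree p = degree (smult (lead_coeff p) (\<Prod>z|poly p z = 0. [:- z, 1:]))" by simp
  also have "\<dots> = card {z. poly p z = 0}"
    using p0 by (subst degree_smult_eq, subst degree_prod_eq_sum_degree) auto
  finally show "card {z. poly p z = 0} = m" by (simp add: p_def)
qed

text \<open>The logarithmic derivative \<open>W = u' / u\<close> satisfies
  \<open>x (W' + W^2) + (a + 1 - x) W + n = 0\<close>. At \<open>x = - c\<close> one has
  \<open>W = - F\<close> and \<open>W' = - Q\<close> with \<open>Q \<ge> 0\<close>, so discarding
  \<open>c * Q\<close> leaves the inequality. For fixed \<open>c\<close> it forces \<open>F\<close>
  to infinity as \<open>n\<close> grows.\<close>

lemma laguerre_resolvent_bound:
  fixes a c :: real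
  assumes A: "finite A" "card A = n" "A \<subseteq> {0<..}" "\<forall>x\<in>A. poly (laguerre n a) x = 0"
    and "c > 0"
  defines "F \<equiv> \<Sum>x\<in>A. 1 / (c + x)"
  shows "c * F\<^sup>2 + (a + 1 + c) * F \<ge> real n"
proof -
  define u where "u = laguerre n a"
  define W where "W = (\<lambda>z. \<Sum>x\<in>A. 1 / (z - x))"
  have u: "u = smult (lead_coeff u) (\<Prod>x\<in>A. [:- x, 1:])"
    using A by (intro poly_eq_prod_roots) (auto simp: u_def)
  have u': "poly (pderiv u) z = poly u z * W z" if "z \<notin> A" for z
    using poly_pderiv_prod_linear[OF A(1) that, of "lead_coeff u"] u unfolding W_def by metis
  have cA: "- c \<notin> A" using A(3) assms(5) by auto
  define Q where "Q = (\<Sum>x\<in>A. 1 / (- c - x)\<^sup>2)"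
  have W': "(W has_real_derivative - Q) (at (- c))"
  proof -
    have "((\<lambda>z. 1 / (z - x)) has_real_derivative - (1 / (- c - x)\<^sup>2)) (at (- c))" if "x \<in> A" for x
      using that cA by (auto intro!: derivative_eq_intros simp: power2_eq_square)
    then show ?thesis unfolding W_def Q_def sum_negf[symmetric] by (rule DERIV_sum)
  qed
  have "((\<lambda>z. poly u z * W z) has_real_derivative
      poly (pderiv u) (- c) * W (- c) + - Q * poly u (- c)) (at (- c))"
    by (rule DERIV_mult[OF poly_DERIV W'])
  moreover have "(poly (pderiv u) has_real_derivative poly (pderiv (pderiv u)) (- c)) (at (- c))"
    by (rule poly_DERIV)
  \<comment> \<open>The functions \<open>u * W\<close> and \<open>u'\<close> agree only off
    \<open>A\<close>, which is enough near \<open>- c\<close>. Equating the two derivatives gives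
    \<open>u'' = u (W^2 - Q)\<close> there.\<close>
  then have "((\<lambda>z. poly u z * W z) has_real_derivative poly (pderiv (pderiv u)) (- c)) (at (- c))"
    by (rule has_field_derivative_transform_within_open[where S = "- A"])
      (use A cA u' in \<open>auto simp: finite_imp_closed\<close>)
  ultimately have u'': "poly (pderiv (pderiv u)) (- c) = poly u (- c) * ((W (- c))\<^sup>2 - Q)"
    using u'[OF cA] by (auto dest: DERIV_unique simp: power2_eq_square algebra_simps)
  have WF: "W (- c) = - F"
    unfolding W_def F_def sum_negf[symmetric]
    by (intro sum.cong refl) (simp add: minus_divide_right)
  have "poly u (- c) * (- c * (F\<^sup>2 - Q) - (a + 1 + c) * F + real n) = 0"
    using laguerre_ode[of "- c" n a] unfolding u_def[symmetric] u'[OF cA] u'' WF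
    by (simp add: algebra_simps)
  moreover have "poly u (- c) \<noteq> 0"
  proof -
    have "lead_coeff u \<noteq> 0" unfolding u_def leading_coeff_0_iff by simp
    then show ?thesis using cA A by (subst u) (auto simp: poly_prod)
  qed
  ultimately have "- c * (F\<^sup>2 - Q) - (a + 1 + c) * F + real n = 0" by simp
  then have "c * F\<^sup>2 + (a + 1 + c) * F = real n + c * Q"
    by (simp add: algebra_simps)
  moreover have "Q \<ge> 0" unfolding Q_def by (intro sum_nonneg) auto
  ultimately show ?thesis using assms(5) by simp
qed

text \<open>For \<open>x > 0\<close> all the numbers \<open>r / (r\<^sup>2 + x)\<close> lie in the right half-plane, so no
  cancellation occurs in the sum.\<close>

lemma resolvent_lower_bound:
  fixes r :: complex
  assumes "finite A" "A \<subseteq> {0<..}" "Re r > 0"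
  shows "Re r * (\<Sum>x\<in>A. 1 / ((cmod r)\<^sup>2 + x)) \<le> cmod r * cmod (\<Sum>x\<in>A. 1 / (- r\<^sup>2 - of_real x))"
proof -
  have summand: "Re r * (1 / ((cmod r)\<^sup>2 + x)) \<le> Re (r / (r\<^sup>2 + of_real x))" if "x \<in> A" for x
  proof -
    have x: "x > 0" using that assms by auto
    define w where "w = r\<^sup>2 + of_real x"
    define N where "N = (cmod r)\<^sup>2 + x"
    have N: "N > 0" using x by (simp add: N_def add_nonneg_pos)
    \<comment> \<open>Here \<open>r * cnj (r^2)\<close> is \<open>cnj r\<close> times the squared
      modulus of \<open>r\<close>, so both parts of \<open>w\<close> contribute a nonnegative
      multiple of \<open>Re r\<close>.\<close>
    have ReN: "Re (r * cnj w) = Re r * N"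
      unfolding w_def N_def cmod_power2 by (simp add: power2_eq_square algebra_simps)
    have "w \<noteq> 0"
    proof
      assume "w = 0"
      then show False using ReN N assms(3) by simp
    qed
    have "cmod w \<le> N"
      using norm_triangle_ineq[of "r\<^sup>2" "of_real x"] x by (simp add: w_def N_def norm_power)
    then have "(cmod w)\<^sup>2 \<le> N\<^sup>2" by (simp add: power_mono)
    then have "Re r * N / N\<^sup>2 \<le> Re r * N / (cmod w)\<^sup>2"
      using \<open>w \<noteq> 0\<close> N assms(3) by (intro divide_left_mono) auto
    also have "\<dots> = Re (r / w)"
      by (simp add: complex_div_cnj[of r w] ReN[symmetric] Re_divide_of_real flip: of_real_power)
    finally show ?thesis using N unfolding w_def[symmetric] N_def[symmetric]
      by (simp add: power2_eq_square)
  qed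
  have "Re r * (\<Sum>x\<in>A. 1 / ((cmod r)\<^sup>2 + x)) \<le> (\<Sum>x\<in>A. Re (r / (r\<^sup>2 + of_real x)))"
    unfolding sum_distrib_left by (rule sum_mono) (rule summand)
  also have "\<dots> = Re (r * (\<Sum>x\<in>A. 1 / (r\<^sup>2 + of_real x)))"
    by (simp add: sum_distrib_left Re_sum)
  also have "\<dots> \<le> cmod (r * (\<Sum>x\<in>A. 1 / (r\<^sup>2 + of_real x)))" by (rule complex_Re_le_cmod)
  also have "(\<Sum>x\<in>A. 1 / (r\<^sup>2 + of_real x)) = - (\<Sum>x\<in>A. 1 / (- r\<^sup>2 - of_real x))"
    unfolding sum_negf[symmetric]
    by (intro sum.cong refl) (metis minus_add minus_divide_right minus_minus uminus_add_conv_diff add.commute)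
  finally show ?thesis by (simp add: norm_mult)
qed

lemma csqrt_Re_pos:
  assumes "z \<notin> \<real>\<^sub>\<le>\<^sub>0" shows "Re (csqrt z) > 0"
proof -
  have "Re (csqrt z) \<noteq> 0"
  proof
    assume "Re (csqrt z) = 0"
    then have "csqrt z = \<i> * of_real (Im (csqrt z))" by (simp add: complex_eq_iff)
    then have "z = (\<i> * of_real (Im (csqrt z)))\<^sup>2" by (metis power2_csqrt)
    then have "z = of_real (- (Im (csqrt z))\<^sup>2)" by (simp add: power_mult_distrib)
    then show False using assms by (metis nonpos_Reals_of_real_iff neg_le_0_iff_le zero_le_power2)
  qed
  then show ?thesis using csqrt_principal[of z] by auto
qed

text \<open>With \<open>z = - r^2\<close> and \<open>Re r > 0\<close>,
  \<open>resolvent_lower_bound\<close> bounds the sum at \<open>z\<close> below by the sum at a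
  negative real point, and the Riccati inequality makes the latter large. Compactness of
  \<open>K\<close> makes the constants uniform.\<close>

lemma laguerre_log_deriv_large:
  fixes a B :: real and K :: "complex set"
  assumes "compact K" "K \<inter> \<real>\<^sub>\<ge>\<^sub>0 = {}"
  shows "eventually (\<lambda>n. \<forall>A. finite A \<longrightarrow> card A = n \<longrightarrow> A \<subseteq> {0<..} \<longrightarrow>
      (\<forall>x\<in>A. poly (laguerre n a) x = 0) \<longrightarrow>
      (\<forall>z\<in>K. B < cmod (\<Sum>x\<in>A. 1 / (z - of_real x)))) sequentially"
proof (cases "K = {}")
  case False
  have neg: "- z \<notin> \<real>\<^sub>\<le>\<^sub>0" if "z \<in> K" for z
    using that assms(2) by (auto simp: complex_nonpos_Reals_iff complex_nonneg_Reals_iff)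
  \<comment> \<open>The cosine of the argument of the square root is the factor lost in passing to
    the negative axis; it is positive and continuous on \<open>K\<close>, hence bounded below there
    by some \<open>\<delta> > 0\<close>.\<close>
  define g where "g = (\<lambda>z. Re (csqrt (- z)) / cmod (csqrt (- z)))"
  have r: "Re (csqrt (- z)) > 0" "cmod (csqrt (- z)) > 0" if "z \<in> K" for z
    using csqrt_Re_pos[OF neg[OF that]] complex_Re_le_cmod[of "csqrt (- z)"] by linarith+
  have "continuous_on K (\<lambda>z. csqrt (- z))"
    by (rule continuous_on_compose2[OF continuous_on_csqrt]) (use neg in \<open>auto intro!: continuous_intros\<close>)
  then have "continuous_on K g"
    unfolding g_def using r
    by (intro continuous_on_divide continuous_on_Re continuous_on_norm) force+
  then obtain z0 where z0: "z0 \<in> K" "\<And>z. z \<in> K \<Longrightarrow> g z0 \<le> g z"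
    using continuous_attains_inf[OF assms(1) False] by blast
  define \<delta> where "\<delta> = g z0"
  have \<delta>: "\<delta> > 0" using r[OF z0(1)] by (simp add: \<delta>_def g_def)
  obtain R where R: "R > 0" "\<And>z. z \<in> K \<Longrightarrow> cmod z \<le> R"
    using compact_imp_bounded[OF assms(1)] bounded_pos by metis
  define b where "b = \<bar>B\<bar> / \<delta> + 1"
  have "\<delta> * b = \<bar>B\<bar> + \<delta>" using \<delta> by (simp add: b_def distrib_left)
  then have b: "b > 0" "B < \<delta> * b"
    using \<delta> by (auto simp: b_def intro!: add_nonneg_pos)
  \<comment> \<open>Beyond this threshold \<open>F \<le> b\<close> would contradict the Riccati
    inequality at \<open>- R\<close>; and \<open>b\<close> is chosen such that
    \<open>\<delta> * b\<close> exceeds \<open>B\<close>.\<close>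
  have "eventually (\<lambda>n. R * b\<^sup>2 + \<bar>a + 1 + R\<bar> * b < real n) sequentially"
    using filterlim_real_sequentially by (simp add: filterlim_at_top_dense)
  then show ?thesis
  proof eventually_elim
    case (elim n)
    show ?case
    proof (intro allI impI ballI)
      fix A z assume A: "finite A" "card A = n" "A \<subseteq> {0<..}" "\<forall>x\<in>A. poly (laguerre n a) x = 0"
        and z: "z \<in> K"
      define F where "F = (\<Sum>x\<in>A. 1 / (R + x))"
      have F0: "F \<ge> 0" unfolding F_def using A R by (intro sum_nonneg) (force intro!: divide_nonneg_pos)
      have "b < F"
      proof (rule ccontr)
        assume "\<not> b < F"
        then have "F \<le> b" by simp
        then have "R * F\<^sup>2 \<le> R * b\<^sup>2" "\<bar>a + 1 + R\<bar> * F \<le> \<bar>a + 1 + R\<bar> * b"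
          using F0 R by (auto intro!: mult_left_mono power_mono)
        moreover have "(a + 1 + R) * F \<le> \<bar>a + 1 + R\<bar> * F" using F0 by (intro mult_right_mono) auto
        moreover have "real n \<le> R * F\<^sup>2 + (a + 1 + R) * F"
          unfolding F_def by (rule laguerre_resolvent_bound[OF A R(1)])
        ultimately show False using elim by linarith
      qed
      define r where "r = csqrt (- z)"
      have r0: "Re r > 0" "cmod r > 0" using r[OF z] by (auto simp: r_def)
      have r2: "- r\<^sup>2 = z" by (simp add: r_def)
      \<comment> \<open>The squared modulus of \<open>r\<close> is the modulus of \<open>z\<close>,
        and the sum grows as the negative point moves towards 0, so a single sum, taken at
        \<open>- R\<close>, serves for all \<open>z\<close> in \<open>K\<close>.\<close>
      have "(cmod r)\<^sup>2 \<le> R" using R(2)[OF z] r2 by (metis norm_minus_cancel norm_power)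
      then have "1 / (R + x) \<le> 1 / ((cmod r)\<^sup>2 + x)" if "x > 0" for x
        using that by (intro divide_left_mono mult_pos_pos add_nonneg_pos) (use R(1) in auto)
      then have "F \<le> (\<Sum>x\<in>A. 1 / ((cmod r)\<^sup>2 + x))"
        unfolding F_def using A(3) by (intro sum_mono) auto
      then have "Re r * F \<le> cmod r * cmod (\<Sum>x\<in>A. 1 / (z - of_real x))"
        using resolvent_lower_bound[OF A(1,3) r0(1)] r0(1) unfolding r2
        by (meson mult_left_mono less_imp_le order_trans)
      then have "g z * F \<le> cmod (\<Sum>x\<in>A. 1 / (z - of_real x))"
      proof -
        assume *: "Re r * F \<le> cmod r * cmod (\<Sum>x\<in>A. 1 / (z - of_real x))"
        have "g z = Re r / cmod r" by (simp only: g_def r_def)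
        then show ?thesis using * r0(2) by (simp add: pos_divide_le_eq mult.commute)
      qed
      moreover have "\<delta> * b < g z * F"
        using z0(2)[OF z] \<delta> b \<open>b < F\<close> unfolding \<delta>_def by (intro mult_le_less_imp_less) auto
      ultimately show "B < cmod (\<Sum>x\<in>A. 1 / (z - of_real x))" using b by linarith
    qed
  qed
qed auto

section \<open>Convergence of the exceptional zeros\<close>

lemma poly_cpoly_exc_darboux:
  "poly (cpoly (exc_darboux m n \<alpha>)) z =
     (let S = cpoly (laguerre_denom m \<alpha>); u = cpoly (laguerre n (\<alpha> + 1)) in
     z * (poly S z * poly (pderiv u) z - poly (pderiv S) z * poly u z)
     + of_real (\<alpha> + 1) * poly S z * poly u z)"
  unfolding exc_darboux_def Let_def cpoly_add cpoly_diff cpoly_mult cpoly_smult cpoly_pCons cpoly_pderiv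
  by (simp add: algebra_simps)

lemma poly_nonzero_in_ball:
  fixes p :: "complex poly"
  assumes "p \<noteq> 0" "e > 0"
  shows "\<exists>z\<in>ball s e. poly p z \<noteq> 0"
proof (rule ccontr)
  assume "\<not> ?thesis"
  then have "ball s e \<subseteq> {z. poly p z = 0}" by auto
  then have "finite (ball s e)" using poly_roots_finite[OF assms(1)] finite_subset by blast
  then show False using uncountable_ball[OF assms(2)] uncountable_infinite by blast
qed

text \<open>Divided by \<open>u'\<close>, the polynomial \<open>exc_darboux\<close> converges to \<open>z S(z)\<close> off the half-line
  because \<open>u / u'\<close> tends to zero there; Hurwitz's theorem then produces the zeros.\<close>

lemma exc_darboux_zero_near:
  assumes \<alpha>: "\<alpha> > real m - 1" "m \<ge> 1" and s: "poly (cpoly (laguerre_denom m \<alpha>)) s = 0" and e: "e > 0"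
  shows "eventually (\<lambda>n. \<exists>z\<in>ball s e. poly (cpoly (exc_darboux m n \<alpha>)) z = 0) sequentially"
proof (rule ccontr)
  assume "\<not> ?thesis"
  from not_eventually_sequentiallyD[OF this] obtain r :: "nat \<Rightarrow> nat" where r: "strict_mono r"
    and r_nz: "\<forall>k. \<not> (\<exists>z\<in>ball s e. poly (cpoly (exc_darboux m (r k) \<alpha>)) z = 0)"
    by blast
  have nz: "poly (cpoly (exc_darboux m (r k) \<alpha>)) z \<noteq> 0" if "z \<in> ball s e" for k z
    using r_nz that by blast
  have "\<alpha> + 1 > -1" using \<alpha> by linarith
  define S where "S = cpoly (laguerre_denom m \<alpha>)"
  define u where "u = (\<lambda>k. cpoly (laguerre k (\<alpha> + 1)))"
  obtain A where A: "\<And>k. finite (A k)" "\<And>k. card (A k) = k" "\<And>k. A k \<subseteq> {0<..}"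
      "\<And>k. \<forall>x\<in>A k. poly (laguerre k (\<alpha> + 1)) x = 0"
    using laguerre_positive_zeros[OF \<open>\<alpha> + 1 > -1\<close>] by metis
  define W where "W = (\<lambda>k z. \<Sum>x\<in>A k. 1 / (z - complex_of_real x))"
  have "s \<in> - \<real>\<^sub>\<ge>\<^sub>0" using laguerre_denom_complex_roots(2)[OF \<alpha>(1) s] by simp
  then obtain d where d: "d > 0" "cball s d \<subseteq> - \<real>\<^sub>\<ge>\<^sub>0"
    by (meson closed_nonneg_Reals_complex open_Compl open_contains_cball)
  define e' where "e' = min d e"
  have e': "e' > 0" "cball s e' \<inter> \<real>\<^sub>\<ge>\<^sub>0 = {}" "ball s e' \<subseteq> ball s e"
    using d e by (auto simp: e'_def)
  let ?K = "cball s e'"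
  have large: "eventually (\<lambda>n. \<forall>z\<in>?K. B < cmod (W n z)) sequentially" for B
    using laguerre_log_deriv_large[of ?K "\<alpha> + 1" B] e' A unfolding W_def
    by (auto elim!: eventually_mono)
  have fac: "u k = smult (lead_coeff (u k)) (\<Prod>x\<in>of_real ` A k. [:- x, 1:])" for k
    using A(1,2,4) unfolding u_def
    by (intro poly_eq_prod_roots) (auto simp: card_image inj_on_def)
  have K0: "z \<notin> of_real ` A k" if "z \<in> ?K" for z k
  proof -
    have "complex_of_real x \<in> \<real>\<^sub>\<ge>\<^sub>0" if "x \<in> A k" for x
      using that A(3)[of k] by (auto simp: less_imp_le subset_iff)
    then show ?thesis using that e'(2) by fastforce
  qed
  have u': "poly (pderiv (u k)) z = poly (u k) z * W k z" if "z \<in> ?K" for z k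
  proof -
    have "(\<Sum>x\<in>of_real ` A k. 1 / (z - x)) = W k z"
      unfolding W_def by (subst sum.reindex) (auto simp: inj_on_def)
    then show ?thesis
      using poly_pderiv_prod_linear[OF _ K0[OF that], of k "lead_coeff (u k)"] A(1) fac[of k] by simp
  qed
  have u0: "poly (u k) z \<noteq> 0" if "z \<in> ?K" for z k
  proof -
    have "lead_coeff (u k) \<noteq> 0" unfolding u_def leading_coeff_0_iff by simp
    then show ?thesis using K0[OF that, of k] A(1)[of k]
      by (subst fac) (auto simp: poly_prod)
  qed
  obtain N where N: "\<And>n z. n \<ge> N \<Longrightarrow> z \<in> ?K \<Longrightarrow> 0 < cmod (W n z)"
    using large[of 0] unfolding eventually_sequentially by blast
  \<comment> \<open>Dropping the first \<open>N\<close> indices makes \<open>W\<close>, and with it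
    \<open>u' = u * W\<close>, zero-free on the disc for every remaining index, so that the quotient
    \<open>f\<close> is holomorphic.\<close>
  define q where "q = (\<lambda>k. r (k + N))"
  have qk: "q k \<ge> k + N" for k using seq_suble[OF r, of "k + N"] by (simp add: q_def)
  have W0: "W (q k) z \<noteq> 0" if "z \<in> ?K" for k z using N[of "q k" z] qk[of k] that by auto
  define f where "f = (\<lambda>k z. poly (cpoly (exc_darboux m (q k) \<alpha>)) z / poly (pderiv (u (q k))) z)"
  \<comment> \<open>Dividing by \<open>u' = u * W\<close> gives \<open>z S - T / W\<close>, where
    \<open>T\<close> is independent of the index and hence bounded on the disc while
    \<open>W\<close> tends to infinity.\<close>
  define T where "T = (\<lambda>z. z * poly (pderiv S) z - of_real (\<alpha> + 1) * poly S z)"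
  have f_eq: "f k z = z * poly S z - T z / W (q k) z" if "z \<in> ?K" for k z
    using u0[OF that, of "q k"] W0[OF that, of k]
    unfolding f_def poly_cpoly_exc_darboux S_def[symmetric] Let_def
    unfolding u_def[symmetric, THEN fun_cong] u'[OF that] T_def
    by (simp add: field_simps)
  have "continuous_on ?K (\<lambda>z. cmod (T z))" unfolding T_def by (intro continuous_intros)
  then obtain M where M: "\<And>z. z \<in> ?K \<Longrightarrow> cmod (T z) \<le> M" "M > 0"
  proof -
    have "bounded ((\<lambda>z. cmod (T z)) ` ?K)"
      using \<open>continuous_on ?K _\<close> by (intro compact_imp_bounded compact_continuous_image) auto
    then show ?thesis using that unfolding bounded_pos by force
  qed
  have lim: "uniform_limit ?K f (\<lambda>z. z * poly S z) sequentially"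
    unfolding uniform_limit_sequentially_iff
  proof (intro allI impI)
    fix \<epsilon> :: real assume \<epsilon>: "\<epsilon> > 0"
    obtain N' where N': "\<And>n z. n \<ge> N' \<Longrightarrow> z \<in> ?K \<Longrightarrow> M / \<epsilon> < cmod (W n z)"
      using large[of "M / \<epsilon>"] unfolding eventually_sequentially by blast
    show "\<exists>N. \<forall>n\<ge>N. \<forall>z\<in>?K. dist (f n z) (z * poly S z) < \<epsilon>"
    proof (intro exI allI impI ballI)
      fix k z assume k: "N' \<le> k" and z: "z \<in> ?K"
      have w: "M / \<epsilon> < cmod (W (q k) z)" using N'[of "q k" z] qk[of k] k z by linarith
      have "dist (f k z) (z * poly S z) = cmod (T z) / cmod (W (q k) z)"
        unfolding f_eq[OF z] by (simp add: dist_norm norm_divide)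
      also have "\<dots> \<le> M / cmod (W (q k) z)" using M(1)[OF z] by (intro divide_right_mono) auto
      also have "\<dots> < \<epsilon>"
      proof -
        have "0 < M / \<epsilon>" using M \<epsilon> by simp
        then have "cmod (W (q k) z) > 0" using w by linarith
        then show ?thesis using w \<epsilon> by (simp add: field_simps)
      qed
      finally show "dist (f k z) (z * poly S z) < \<epsilon>" .
    qed
  qed
  \<comment> \<open>If no \<open>f k\<close> had a zero in the disc, Hurwitz's theorem would make
    the nonconstant limit \<open>z S(z)\<close> zero-free there, against
    \<open>S(s) = 0\<close>.\<close>
  have "s * poly S s \<noteq> 0"
  proof (rule Hurwitz_no_zeros[of "ball s e'" f "\<lambda>z. z * poly S z" s])
    show "f k holomorphic_on ball s e'" for k
      unfolding f_def
    proof (intro holomorphic_intros)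
      show "poly (pderiv (u (q k))) z \<noteq> 0" if "z \<in> ball s e'" for z
        using u'[of z "q k"] u0[of z "q k"] W0[of z k] that by (auto simp: less_imp_le)
    qed
    show "uniform_limit K f (\<lambda>z. z * poly S z) sequentially" if "K \<subseteq> ball s e'" for K
      using lim by (rule uniform_limit_on_subset) (use that ball_subset_cball in blast)
    show "\<not> (\<lambda>z. z * poly S z) constant_on ball s e'"
    proof
      assume "(\<lambda>z. z * poly S z) constant_on ball s e'"
      then have "\<forall>z\<in>ball s e'. z * poly S z = s * poly S s"
        using e' unfolding constant_on_def by force
      then have "\<forall>z\<in>ball s e'. poly (pCons 0 S) z = 0" using s by (simp add: S_def)
      then show False using poly_nonzero_in_ball[of "pCons 0 S" e' s] e' by (auto simp: S_def)
    qed
    show "f k z \<noteq> 0" if "z \<in> ball s e'" for k z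
      using that nz[of z "k + N"] e'(3) u'[of z "q k"] u0[of z "q k"] W0[of z k]
      by (auto simp: f_def q_def)
  qed (use e' in \<open>auto intro!: holomorphic_intros\<close>)
  then show False using s by (simp add: S_def)
qed

text \<open>A count: the \<open>n\<close> positive zeros and one zero near each of the
  \<open>m\<close> zeros of \<open>S\<close> are distinct, and together they number the degree
  \<open>m + n\<close>. Hence there are no others and all are simple.\<close>

lemma exc_darboux_factorization:
  assumes \<alpha>: "\<alpha> > real m - 1" "m \<ge> 1" and e: "e > 0"
  defines "\<Sigma> \<equiv> {s. poly (cpoly (laguerre_denom m \<alpha>)) s = 0}"
  shows "eventually (\<lambda>n. \<exists>B \<zeta>. finite B \<and> card B = n \<and> B \<subseteq> {0<..} \<and>
      (\<forall>x\<in>B. poly (exc_darboux m n \<alpha>) x = 0) \<and>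
      inj_on \<zeta> \<Sigma> \<and> (\<forall>s\<in>\<Sigma>. \<zeta> s \<in> ball s e \<and> \<zeta> s \<notin> \<real>\<^sub>\<ge>\<^sub>0) \<and>
      cpoly (exc_darboux m n \<alpha>) = smult (of_real (lead_coeff (exc_darboux m n \<alpha>)))
        ((\<Prod>x\<in>B. [:- of_real x, 1:]) * (\<Prod>s\<in>\<Sigma>. [:- \<zeta> s, 1:]))) sequentially"
proof -
  have fin: "finite \<Sigma>" and card: "card \<Sigma> = m"
    unfolding \<Sigma>_def using laguerre_denom_complex_roots(1)[OF \<alpha>(1)] by (auto intro: poly_roots_finite)
  have "\<exists>d>0. ball s d \<inter> ((\<Sigma> - {s}) \<union> \<real>\<^sub>\<ge>\<^sub>0) = {}" if "s \<in> \<Sigma>" for s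
  proof -
    have "open (- ((\<Sigma> - {s}) \<union> \<real>\<^sub>\<ge>\<^sub>0 :: complex set))"
      using fin by (intro open_Compl closed_Un closed_nonneg_Reals_complex finite_imp_closed) auto
    moreover have "s \<in> - ((\<Sigma> - {s}) \<union> \<real>\<^sub>\<ge>\<^sub>0)"
      using that laguerre_denom_complex_roots(2)[OF \<alpha>(1)] by (auto simp: \<Sigma>_def)
    ultimately show ?thesis by (metis open_contains_ball disjoint_eq_subset_Compl)
  qed
  then obtain d where d: "\<And>s. s \<in> \<Sigma> \<Longrightarrow> d s > 0"
    "\<And>s. s \<in> \<Sigma> \<Longrightarrow> ball s (d s) \<inter> ((\<Sigma> - {s}) \<union> \<real>\<^sub>\<ge>\<^sub>0) = {}" by metis
  \<comment> \<open>Each ball of radius \<open>d s\<close> avoids the half-line and the other zeros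
    of \<open>S\<close>. With half that radius two of the balls cannot share a point, which makes
    \<open>\<zeta>\<close> injective.\<close>
  define e' where "e' = Min (insert e ((\<lambda>s. d s / 2) ` \<Sigma>))"
  have e': "e' > 0" "e' \<le> e" using fin e d(1) by (auto simp: e'_def)
  have e'd: "e' \<le> d s / 2" if "s \<in> \<Sigma>" for s
    unfolding e'_def using fin that by (intro Min_le) auto
  have "eventually (\<lambda>n. \<forall>s\<in>\<Sigma>. \<exists>z\<in>ball s e'. poly (cpoly (exc_darboux m n \<alpha>)) z = 0) sequentially"
    using fin exc_darboux_zero_near[OF \<alpha> _ e'(1)]
    by (intro eventually_ball_finite) (auto simp: \<Sigma>_def)
  then show ?thesis
  proof eventually_elim
    case (elim n)
    define L where "L = exc_darboux m n \<alpha>"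
    have degL: "degree L = m + n" using exc_darboux_exc_laguerre2[OF \<alpha>(1), of n] by (simp add: L_def exc_laguerre2_iff)
    obtain \<zeta> where \<zeta>: "\<And>s. s \<in> \<Sigma> \<Longrightarrow> \<zeta> s \<in> ball s e'" "\<And>s. s \<in> \<Sigma> \<Longrightarrow> poly (cpoly L) (\<zeta> s) = 0"
      using elim unfolding L_def by metis
    obtain B where B: "finite B" "card B = n" "B \<subseteq> {0<..}" "\<forall>x\<in>B. poly L x = 0"
      using exc_darboux_positive_zeros[OF \<alpha>] unfolding L_def by metis
    have inj: "inj_on \<zeta> \<Sigma>"
    proof (rule inj_onI, rule ccontr)
      fix s t assume st: "s \<in> \<Sigma>" "t \<in> \<Sigma>" "\<zeta> s = \<zeta> t" "s \<noteq> t"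
      have "dist s t \<le> dist s (\<zeta> s) + dist t (\<zeta> t)"
        using st(3) dist_triangle2[of s t "\<zeta> s"] by simp
      also have "\<dots> < d s / 2 + d s / 2"
        using \<zeta>(1)[OF st(1)] \<zeta>(1)[OF st(2)] e'd[OF st(1)] e'd[OF st(2)] by (auto intro!: add_strict_mono)
      finally have "t \<in> ball s (d s)" by simp
      then show False using d(2)[OF st(1)] st by auto
    qed
    have off: "\<zeta> s \<in> ball s e \<and> \<zeta> s \<notin> \<real>\<^sub>\<ge>\<^sub>0" if "s \<in> \<Sigma>" for s
    proof -
      have "\<zeta> s \<in> ball s (d s)" "\<zeta> s \<in> ball s e"
        using \<zeta>(1)[OF that] e'(2) e'd[OF that] d(1)[OF that] by auto
      then show ?thesis using d(2)[OF that] by auto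
    qed
    have "complex_of_real x \<in> \<real>\<^sub>\<ge>\<^sub>0" if "x \<in> B" for x
      using that B(3) by (auto simp: less_imp_le subset_iff)
    then have disj: "complex_of_real ` B \<inter> \<zeta> ` \<Sigma> = {}"
      using off by fastforce
    define R where "R = complex_of_real ` B \<union> \<zeta> ` \<Sigma>"
    have "card R = m + n"
      unfolding R_def using disj fin B inj card
      by (subst card_Un_disjoint) (auto simp: card_image inj_on_def)
    then have "cpoly L = smult (lead_coeff (cpoly L)) (\<Prod>x\<in>R. [:- x, 1:])"
      using degL fin B \<zeta>(2) by (intro poly_eq_prod_roots) (auto simp: R_def)
    also have "lead_coeff (cpoly L) = of_real (lead_coeff L)" by (simp add: coeff_map_poly)
    also have "(\<Prod>x\<in>R. [:- x, 1:]) = (\<Prod>x\<in>B. [:- of_real x, 1:]) * (\<Prod>s\<in>\<Sigma>. [:- \<zeta> s, 1:])"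
      unfolding R_def using disj fin B inj
      by (subst prod.union_disjoint) (auto simp: prod.reindex inj_on_def)
    finally show ?case using B inj off unfolding L_def by blast
  qed
qed

section \<open>Log-concavity of the weight\<close>

text \<open>After absorbing \<open>x * y\<close>, the claim concerns products of quotients
  \<open>x / (x - s)\<close>, which are bounded for \<open>x > 0\<close> and change uniformly little
  when \<open>s\<close> moves. The weight \<open>x * y\<close> matches the divided difference
  \<open>(\<alpha> + 1) / (x * y)\<close> of \<open>(\<alpha> + 1) / x\<close>, against which the
  error is later set.\<close>

lemma resolvent_perturbation:
  assumes s: "s \<notin> \<real>\<^sub>\<ge>\<^sub>0" and "\<beta> > 0"
  shows "\<exists>e>0. \<forall>z\<in>ball s e. \<forall>x>0. \<forall>y>0.
    x * y * cmod (1 / ((of_real x - z) * (of_real y - z)) - 1 / ((of_real x - s) * (of_real y - s))) \<le> \<beta>"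
proof -
  have "open (- \<real>\<^sub>\<ge>\<^sub>0 :: complex set)" by (intro open_Compl closed_nonneg_Reals_complex)
  then obtain \<delta> where \<delta>: "\<delta> > 0" "ball s \<delta> \<subseteq> - \<real>\<^sub>\<ge>\<^sub>0"
    using s by (meson ComplI open_contains_ball)
  have far: "cmod (of_real x - s) \<ge> \<delta>" if "x > 0" for x :: real
  proof (rule ccontr)
    assume "\<not> ?thesis"
    then have "of_real x \<in> ball s \<delta>" by (simp add: dist_norm norm_minus_commute)
    then show False using \<delta>(2) that by auto
  qed
  define M where "M = 1 + cmod s / \<delta>"
  have M: "M > 0" using \<delta> by (simp add: M_def add_pos_nonneg)
  \<comment> \<open>If both quotients are bounded by \<open>M\<close> and change by at most
    \<open>\<eta>\<close>, their product changes by at most \<open>\<eta>^2 + 2 M \<eta>\<close>,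
    which for \<open>\<eta> \<le> 1\<close> is at most \<open>\<eta> (2 M + 1)\<close>.\<close>
  define \<eta> where "\<eta> = min 1 (\<beta> / (2 * M + 1))"
  have "\<eta> \<le> \<beta> / (2 * M + 1)" by (simp add: \<eta>_def)
  then have "\<eta> * (2 * M + 1) \<le> \<beta>" using M by (simp add: pos_le_divide_eq)
  moreover have "\<eta> > 0" "\<eta> \<le> 1" using M assms(2) by (auto simp: \<eta>_def)
  ultimately have \<eta>: "\<eta> > 0" "\<eta> \<le> 1" "\<eta> * (2 * M + 1) \<le> \<beta>" by simp_all
  \<comment> \<open>The first bound keeps \<open>z\<close> at distance at least
    \<open>\<delta> / 2\<close> from the positive axis; the second makes the change of the quotient,
    \<open>b x * (z - s) / (x - z)\<close>, at most \<open>\<eta>\<close>.\<close>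
  define e where "e = min (\<delta> / 2) (\<eta> * \<delta> / (2 * M))"
  have e: "e > 0" "e \<le> \<delta> / 2" "M * e / (\<delta> / 2) \<le> \<eta>"
  proof -
    show "e > 0" "e \<le> \<delta> / 2" using \<delta> \<eta> M by (auto simp: e_def)
    have "M * e \<le> M * (\<eta> * \<delta> / (2 * M))" using M by (intro mult_left_mono) (auto simp: e_def)
    then show "M * e / (\<delta> / 2) \<le> \<eta>" using M \<delta> by (simp add: field_simps)
  qed
  define b where "b = (\<lambda>x. complex_of_real x / (of_real x - s))"
  have b: "cmod (b x) \<le> M" if "x > 0" for x
  proof -
    have "of_real x - s \<noteq> 0" using far[OF that] \<delta> by auto
    then have "b x = 1 + s / (of_real x - s)" by (simp add: b_def field_simps)
    then have "cmod (b x) \<le> 1 + cmod s / cmod (of_real x - s)"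
      by (metis norm_divide norm_one norm_triangle_ineq)
    also have "\<dots> \<le> M" unfolding M_def using far[OF that] \<delta>
      by (intro add_left_mono divide_left_mono mult_pos_pos) auto
    finally show ?thesis .
  qed
  have "x * y * cmod (1 / ((of_real x - z) * (of_real y - z)) - 1 / ((of_real x - s) * (of_real y - s))) \<le> \<beta>"
    if z: "z \<in> ball s e" and x: "x > 0" and y: "y > 0" for z x y
  proof -
    define a where "a = (\<lambda>x. complex_of_real x / (of_real x - z))"
    have diff: "cmod (a x - b x) \<le> \<eta>" if "x > 0" for x
    proof -
      have zs: "cmod (z - s) < e" using z by (simp add: dist_norm norm_minus_commute)
      have "cmod (of_real x - s) \<le> cmod (of_real x - z) + cmod (z - s)"
        using norm_triangle_ineq[of "of_real x - z" "z - s"] by simp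
      then have far': "cmod (of_real x - z) \<ge> \<delta> / 2"
        using far[OF that] zs e(2) by (simp add: field_simps)
      then have nz: "of_real x - z \<noteq> 0" "of_real x - s \<noteq> 0"
        using far[OF that] \<delta> by auto
      then have "a x - b x = b x * (z - s) / (of_real x - z)"
        by (simp add: a_def b_def field_simps)
      then have "cmod (a x - b x) = cmod (b x) * cmod (z - s) / cmod (of_real x - z)"
        by (simp add: norm_mult norm_divide)
      also have "\<dots> \<le> M * e / (\<delta> / 2)"
        using b[OF that] zs far' \<delta> M e(1) by (intro frac_le mult_mono) auto
      finally show ?thesis using e(3) by simp
    qed
    have "cmod (a x * a y - b x * b y) = cmod ((a x - b x) * (a y - b y) + (a x - b x) * b y + b x * (a y - b y))"
      by (simp add: algebra_simps)
    also have "\<dots> \<le> cmod (a x - b x) * cmod (a y - b y) + cmod (a x - b x) * cmod (b y) + cmod (b x) * cmod (a y - b y)"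
      by (intro norm_triangle_le add_mono) (auto simp: norm_mult)
    also have "\<dots> \<le> \<eta> * \<eta> + \<eta> * M + M * \<eta>"
      using diff[OF x] diff[OF y] b[OF x] b[OF y] \<eta>(1) M by (intro add_mono mult_mono) auto
    also have "\<dots> \<le> \<eta> * (2 * M + 1)"
      using \<eta>(1,2) by (simp add: algebra_simps mult_left_le)
    also have "\<dots> \<le> \<beta>" by (rule \<eta>(3))
    also have "a x * a y - b x * b y = of_real (x * y) *
        (1 / ((of_real x - z) * (of_real y - z)) - 1 / ((of_real x - s) * (of_real y - s)))"
      by (simp add: a_def b_def right_diff_distrib)
    finally show ?thesis using x y by (simp add: norm_mult)
  qed
  then show ?thesis using e(1) by blast
qed

lemma prod_linear_dvd:
  fixes p :: "'a :: field poly"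
  assumes "finite A" "\<And>x. x \<in> A \<Longrightarrow> poly p x = 0"
  shows "(\<Prod>x\<in>A. [:- x, 1:]) dvd p"
  using assms
proof (induction A arbitrary: p rule: finite_induct)
  case (insert b A)
  obtain q where q: "p = [:- b, 1:] * q"
    using insert.prems[of b] by (auto simp: poly_eq_0_iff_dvd)
  have "poly q x = 0" if "x \<in> A" for x
    using insert.prems[of x] insert.hyps that by (auto simp: q)
  then have "(\<Prod>x\<in>A. [:- x, 1:]) dvd q" by (rule insert.IH)
  then show ?case unfolding q prod.insert[OF insert.hyps] by (rule mult_dvd_mono[OF dvd_refl])
qed simp

lemma poly_pderiv_prod_linear_inj:
  fixes c :: "'a :: field"
  assumes p: "p = smult c (\<Prod>s\<in>A. [:- \<zeta> s, 1:])"
    and "finite A" "inj_on \<zeta> A" "\<And>s. s \<in> A \<Longrightarrow> z \<noteq> \<zeta> s"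
  shows "poly (pderiv p) z = poly p z * (\<Sum>s\<in>A. 1 / (z - \<zeta> s))"
proof -
  have p': "p = smult c (\<Prod>x\<in>\<zeta> ` A. [:- x, 1:])"
    unfolding p using assms(3) by (simp add: prod.reindex)
  have "poly (pderiv p) z = poly p z * (\<Sum>x\<in>\<zeta> ` A. 1 / (z - x))"
    unfolding p' by (rule poly_pderiv_prod_linear) (use assms in auto)
  then show ?thesis using assms(3) by (simp add: sum.reindex)
qed

definition log_weight_deriv :: "nat \<Rightarrow> real \<Rightarrow> real poly \<Rightarrow> real \<Rightarrow> real" where
  "log_weight_deriv m \<alpha> L x = (let P = exceptional_factor L; S = laguerre_denom m \<alpha> in
     (\<alpha> + 1) / x - 1 + 2 * poly (pderiv P) x / poly P x - 2 * poly (pderiv S) x / poly S x)"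

lemma ln_exc_weight_deriv:
  assumes "x > 0" "poly (exceptional_factor L) x \<noteq> 0" "poly (laguerre_denom m \<alpha>) x \<noteq> 0"
  shows "((\<lambda>x. ln (exc_weight m \<alpha> L x)) has_real_derivative log_weight_deriv m \<alpha> L x) (at x)"
proof -
  define P S where "P = exceptional_factor L" and "S = laguerre_denom m \<alpha>"
  have [derivative_intros]: "(poly p has_real_derivative poly (pderiv p) y) (at y)" for p y
    by (rule poly_DERIV)
  have w: "exc_weight m \<alpha> L = (\<lambda>x. x powr (\<alpha> + 1) * exp (- x) * (poly P x)\<^sup>2 / (poly S x)\<^sup>2)"
    by (simp add: fun_eq_iff exc_weight_def P_def S_def)
  have nz: "poly P x \<noteq> 0" "poly S x \<noteq> 0" using assms by (auto simp: P_def S_def)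
  have pos: "exc_weight m \<alpha> L x > 0" unfolding w using assms(1) nz by simp
  have "(exc_weight m \<alpha> L has_real_derivative exc_weight m \<alpha> L x * log_weight_deriv m \<alpha> L x) (at x)"
  proof -
    have e1: "x powr (\<alpha> + 1) = x * x powr \<alpha>" using assms(1) by (simp add: powr_add)
    show ?thesis
      unfolding w log_weight_deriv_def P_def[symmetric] S_def[symmetric] Let_def using assms(1) nz
      by (auto intro!: derivative_eq_intros simp: e1) (simp add: field_simps e1 power2_eq_square power4_eq_xxxx)
  qed
  from DERIV_chain2[OF DERIV_ln_divide[OF pos] this] show ?thesis using pos by simp
qed

lemma tangent_strict:
  fixes g h :: "real \<Rightarrow> real"
  assumes "\<And>x. x > 0 \<Longrightarrow> (g has_real_derivative h x) (at x)"
    and "strict_antimono_on {0<..} h" and "x > 0" "z > 0" "x \<noteq> z"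
  shows "g x < g z + h z * (x - z)"
proof (cases x z rule: linorder_cases)
  case less
  obtain \<xi> where \<xi>: "x < \<xi>" "\<xi> < z" "g z - g x = (z - x) * h \<xi>"
    using MVT2[of x z g h] less assms by auto
  have "h z < h \<xi>" using assms(2) \<xi> \<open>x > 0\<close> by (intro monotone_onD[OF assms(2)]) auto
  then have "(z - x) * h z < (z - x) * h \<xi>" using less by simp
  then show ?thesis using \<xi> by (simp add: algebra_simps)
next
  case greater
  obtain \<xi> where \<xi>: "z < \<xi>" "\<xi> < x" "g x - g z = (x - z) * h \<xi>"
    using MVT2[of z x g h] greater assms by auto
  have "h \<xi> < h z" using assms(2) \<xi> \<open>z > 0\<close> by (intro monotone_onD[OF assms(2)]) auto
  then have "(x - z) * h \<xi> < (x - z) * h z" using greater by simp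
  then show ?thesis using \<xi> by (simp add: algebra_simps)
qed (use assms in auto)

text \<open>Collects what the maximisation needs for large \<open>n\<close>. Concavity comes from
  the zeros of \<open>P\<close> being close to those of \<open>S\<close>; criticality is the
  differential equation evaluated at a zero of \<open>L\<close>.\<close>

lemma exc_weight_critical_log_concave:
  assumes \<alpha>: "\<alpha> > real m - 1" "m \<ge> 1"
  shows "eventually (\<lambda>n. \<forall>L. exc_laguerre2 m n \<alpha> L \<longrightarrow>
     finite (regular_zeros L) \<and> card (regular_zeros L) = n \<and>
     (\<forall>x>0. exc_weight m \<alpha> L x > 0 \<and>
       ((\<lambda>x. ln (exc_weight m \<alpha> L x)) has_real_derivative log_weight_deriv m \<alpha> L x) (at x)) \<and>
     strict_antimono_on {0<..} (log_weight_deriv m \<alpha> L) \<and>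
     (\<forall>x\<in>regular_zeros L. log_weight_deriv m \<alpha> L x + (\<Sum>y\<in>regular_zeros L - {x}. 2 / (x - y)) = 0))
   sequentially"
proof -
  define S where "S = laguerre_denom m \<alpha>"
  define \<Sigma> where "\<Sigma> = {s. poly (cpoly S) s = 0}"
  \<comment> \<open>The \<open>m\<close> zeros together disturb the real part by at most a quarter
    of \<open>(\<alpha> + 1) / (x * y)\<close>. The factor 2 from the squares in the weight turns
    this into a half, so the main term wins.\<close>
  define \<beta> where "\<beta> = (\<alpha> + 1) / (4 * real m)"
  have "\<alpha> + 1 > 0" using \<alpha> by linarith
  then have \<beta>: "\<beta> > 0" using \<alpha> by (simp add: \<beta>_def)
  have fin: "finite \<Sigma>" and card: "card \<Sigma> = m" and \<Sigma>off: "\<And>s. s \<in> \<Sigma> \<Longrightarrow> s \<notin> \<real>\<^sub>\<ge>\<^sub>0"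
    unfolding \<Sigma>_def S_def using laguerre_denom_complex_roots[OF \<alpha>(1)] by (auto intro: poly_roots_finite)
  have cS: "cpoly S = smult (lead_coeff (cpoly S)) (\<Prod>s\<in>\<Sigma>. [:- s, 1:])"
    using fin card by (intro poly_eq_prod_roots) (auto simp: \<Sigma>_def S_def)
  have "\<forall>s\<in>\<Sigma>. \<exists>e>0. \<forall>z\<in>ball s e. \<forall>x>0. \<forall>y>0.
    x * y * cmod (1 / ((of_real x - z) * (of_real y - z)) - 1 / ((of_real x - s) * (of_real y - s))) \<le> \<beta>"
    using resolvent_perturbation[OF \<Sigma>off \<beta>] by blast
  then obtain d where d: "\<And>s. s \<in> \<Sigma> \<Longrightarrow> d s > 0"
    "\<And>s z x y. s \<in> \<Sigma> \<Longrightarrow> z \<in> ball s (d s) \<Longrightarrow> x > 0 \<Longrightarrow> y > 0 \<Longrightarrow>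
    x * y * cmod (1 / ((of_real x - z) * (of_real y - z)) - 1 / ((of_real x - s) * (of_real y - s))) \<le> \<beta>"
    by metis
  define e where "e = Min (insert 1 (d ` \<Sigma>))"
  have e: "e > 0" "\<And>s. s \<in> \<Sigma> \<Longrightarrow> e \<le> d s"
    using fin d(1) by (auto simp: e_def)
  show ?thesis
    using exc_darboux_factorization[OF \<alpha> e(1)]
  proof eventually_elim
    case (elim n)
    show ?case
    proof (intro allI impI)
      fix L assume "exc_laguerre2 m n \<alpha> L"
      then obtain c where c: "c \<noteq> 0" "L = smult c (exc_darboux m n \<alpha>)"
        using exc_laguerre2_unique[of m n \<alpha> L] \<alpha> by auto
      have L0: "L \<noteq> 0" "exc_op m n \<alpha> L = 0"
        using \<open>exc_laguerre2 m n \<alpha> L\<close> \<alpha> by (auto simp: exc_laguerre2_iff)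
      obtain B \<zeta> where B: "finite B" "card B = n" "B \<subseteq> {0<..}" "\<forall>x\<in>B. poly L x = 0"
        and \<zeta>: "inj_on \<zeta> \<Sigma>" "\<And>s. s \<in> \<Sigma> \<Longrightarrow> \<zeta> s \<in> ball s e" "\<And>s. s \<in> \<Sigma> \<Longrightarrow> \<zeta> s \<notin> \<real>\<^sub>\<ge>\<^sub>0"
        and fac: "cpoly L = smult (of_real (lead_coeff L)) ((\<Prod>x\<in>B. [:- of_real x, 1:]) * (\<Prod>s\<in>\<Sigma>. [:- \<zeta> s, 1:]))"
        using elim unfolding c(2) S_def[symmetric] \<Sigma>_def[symmetric]
        by (force simp: cpoly_smult)
      have notz: "of_real x \<noteq> \<zeta> s" "of_real x \<noteq> s" if "x > 0" "s \<in> \<Sigma>" for x :: real and s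
        using \<zeta>(3)[OF that(2)] \<Sigma>off[OF that(2)] that(1)
        by (metis less_imp_le nonneg_Reals_of_real_iff)+
      \<comment> \<open>The zeros \<open>\<zeta> s\<close> lie off the half-line, so a positive zero
        of \<open>L\<close> must come from \<open>B\<close>.\<close>
      have reg: "regular_zeros L = B"
      proof (intro equalityI subsetI)
        fix x assume "x \<in> regular_zeros L"
        then have x: "x > 0" "poly L x = 0" by (auto simp: regular_zeros_def)
        then have "poly (cpoly L) (of_real x) = 0" by simp
        then show "x \<in> B" using notz(1)[OF x(1)] L0 fin B(1)
          unfolding fac by (auto simp: poly_prod)
      qed (use B in \<open>auto simp: regular_zeros_def\<close>)
      define P where "P = exceptional_factor L"
      define q where "q = (\<Prod>x\<in>B. [:- x, 1:])"
      \<comment> \<open>The product over \<open>B\<close> divides \<open>L\<close>, so the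
        \<open>div\<close> in \<open>exceptional_factor\<close> is exact.\<close>
      have Lq: "L = P * q"
        unfolding P_def exceptional_factor_def regular_factor_def reg q_def
        using prod_linear_dvd[OF B(1), of L] B(4) by simp
      have cq: "cpoly q = (\<Prod>x\<in>B. [:- of_real x, 1:])"
        by (simp add: q_def cpoly_prod cpoly_pCons)
      have "cpoly q \<noteq> 0" using L0 Lq by auto
      moreover have "cpoly q * cpoly P = cpoly q * smult (of_real (lead_coeff L)) (\<Prod>s\<in>\<Sigma>. [:- \<zeta> s, 1:])"
        using fac unfolding cq[symmetric] by (simp add: Lq cpoly_mult mult.commute)
      ultimately have cP: "cpoly P = smult (of_real (lead_coeff L)) (\<Prod>s\<in>\<Sigma>. [:- \<zeta> s, 1:])"
        using mult_left_cancel by blast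
      have Pnz: "poly P x \<noteq> 0" and Snz: "poly S x \<noteq> 0" if "x > 0" for x
      proof -
        have "poly (cpoly P) (of_real x) \<noteq> 0"
          unfolding cP using notz(1)[OF that] fin L0 by (auto simp: poly_prod)
        then show "poly P x \<noteq> 0" by simp
        show "poly S x \<noteq> 0" unfolding S_def using \<alpha> that by (intro laguerre_denom_nonneg_nonzero) auto
      qed
      define h where "h = log_weight_deriv m \<alpha> L"
      have h: "h x = (\<alpha> + 1) / x - 1 + 2 * poly (pderiv P) x / poly P x - 2 * poly (pderiv S) x / poly S x" for x
        by (simp only: h_def log_weight_deriv_def P_def S_def Let_def)
      \<comment> \<open>Each zero of \<open>P\<close> is paired with the nearby zero of
        \<open>S\<close>. The zeros may be nonreal, hence the complex sum, whose value is
        nevertheless real.\<close>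
      have hc: "h x = (\<alpha> + 1) / x - 1 + 2 * Re (\<Sum>s\<in>\<Sigma>. 1 / (of_real x - \<zeta> s) - 1 / (of_real x - s))"
        if "x > 0" for x
      proof -
        have "complex_of_real (poly (pderiv P) x / poly P x) = (\<Sum>s\<in>\<Sigma>. 1 / (of_real x - \<zeta> s))"
          using poly_pderiv_prod_linear_inj[OF cP fin \<zeta>(1), of "of_real x"] notz(1)[OF that] Pnz[OF that]
          by (simp add: cpoly_pderiv[symmetric] of_real_divide)
        moreover have "complex_of_real (poly (pderiv S) x / poly S x) = (\<Sum>s\<in>\<Sigma>. 1 / (of_real x - s))"
          using poly_pderiv_prod_linear_inj[OF cS fin inj_on_id2, of "of_real x"] notz(2)[OF that] Snz[OF that]
          by (simp add: cpoly_pderiv[symmetric] of_real_divide)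
        ultimately have "complex_of_real (poly (pderiv P) x / poly P x - poly (pderiv S) x / poly S x)
          = (\<Sum>s\<in>\<Sigma>. 1 / (of_real x - \<zeta> s) - 1 / (of_real x - s))"
          by (simp add: sum_subtractf)
        then have "poly (pderiv P) x / poly P x - poly (pderiv S) x / poly S x
          = Re (\<Sum>s\<in>\<Sigma>. 1 / (of_real x - \<zeta> s) - 1 / (of_real x - s))"
          by (metis Re_complex_of_real)
        then show ?thesis unfolding h by simp
      qed
      \<comment> \<open>The difference \<open>1 / (x - w) - 1 / (y - w)\<close> is
        \<open>(y - x) / ((x - w) (y - w))\<close>, so \<open>h x - h y\<close> is
        \<open>y - x\<close> times an expression that \<open>resolvent_perturbation\<close> keeps
        positive.\<close>
      have anti: "h y < h x" if xy: "x > 0" "x < y" for x y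
      proof -
        have y: "y > 0" using xy by simp
        define T where "T = (\<lambda>s. 1 / ((of_real x - \<zeta> s) * (of_real y - \<zeta> s)) - 1 / ((of_real x - s) * (of_real y - s)))"
        have T: "1 / (of_real x - \<zeta> s) - 1 / (of_real x - s) - (1 / (of_real y - \<zeta> s) - 1 / (of_real y - s))
            = of_real (y - x) * T s" if "s \<in> \<Sigma>" for s
        proof -
          have r: "1 / (of_real x - w) - 1 / (of_real y - w) = of_real (y - x) * (1 / ((of_real x - w) * (of_real y - w)))"
            if "of_real x \<noteq> w" "of_real y \<noteq> w" for w :: complex
            using that by (simp add: divide_simps)
          have "1 / (of_real x - \<zeta> s) - 1 / (of_real x - s) - (1 / (of_real y - \<zeta> s) - 1 / (of_real y - s))
              = (1 / (of_real x - \<zeta> s) - 1 / (of_real y - \<zeta> s)) - (1 / (of_real x - s) - 1 / (of_real y - s))"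
            by simp
          also have "\<dots> = of_real (y - x) * T s"
            unfolding r[OF notz(1)[OF xy(1) that] notz(1)[OF y that]]
              r[OF notz(2)[OF xy(1) that] notz(2)[OF y that]] T_def right_diff_distrib ..
          finally show ?thesis .
        qed
        have sumT: "(\<Sum>s\<in>\<Sigma>. 1 / (of_real x - \<zeta> s) - 1 / (of_real x - s))
            - (\<Sum>s\<in>\<Sigma>. 1 / (of_real y - \<zeta> s) - 1 / (of_real y - s)) = (\<Sum>s\<in>\<Sigma>. of_real (y - x) * T s)"
          unfolding sum_subtractf[symmetric] by (intro sum.cong refl T)
        have "h x - h y = (\<alpha> + 1) / x - (\<alpha> + 1) / y + 2 * Re (\<Sum>s\<in>\<Sigma>. of_real (y - x) * T s)"
          unfolding hc[OF xy(1)] hc[OF y] sumT[symmetric] minus_complex.simps by simp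
        also have "(\<Sum>s\<in>\<Sigma>. of_real (y - x) * T s) = of_real (y - x) * (\<Sum>s\<in>\<Sigma>. T s)"
          by (simp only: sum_distrib_left)
        also have "Re \<dots> = (y - x) * Re (\<Sum>s\<in>\<Sigma>. T s)" by simp
        also have "(\<alpha> + 1) / x - (\<alpha> + 1) / y = (y - x) * ((\<alpha> + 1) / (x * y))"
          using xy y by (simp add: field_simps)
        finally have hxy: "h x - h y = (y - x) * ((\<alpha> + 1) / (x * y) + 2 * Re (\<Sum>s\<in>\<Sigma>. T s))"
          by (simp add: algebra_simps)
        have "\<bar>Re (\<Sum>s\<in>\<Sigma>. T s)\<bar> \<le> cmod (\<Sum>s\<in>\<Sigma>. T s)" by (rule abs_Re_le_cmod)
        also have "\<dots> \<le> (\<Sum>s\<in>\<Sigma>. cmod (T s))" by (rule norm_sum)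
        also have "\<dots> \<le> (\<Sum>s\<in>\<Sigma>. \<beta> / (x * y))"
        proof (rule sum_mono)
          fix s assume s: "s \<in> \<Sigma>"
          have "\<zeta> s \<in> ball s (d s)" using \<zeta>(2)[OF s] e(2)[OF s] by auto
          from d(2)[OF s this xy(1) y] show "cmod (T s) \<le> \<beta> / (x * y)"
            using xy y by (simp add: T_def field_simps)
        qed
        also have "\<dots> = (\<alpha> + 1) / (x * y) / 4"
          using \<alpha>(2) by (simp add: card \<beta>_def)
        finally have "\<bar>Re (\<Sum>s\<in>\<Sigma>. T s)\<bar> \<le> (\<alpha> + 1) / (x * y) / 4" .
        moreover have "(\<alpha> + 1) / (x * y) > 0" using \<open>\<alpha> + 1 > 0\<close> xy y by simp
        moreover have "t + 2 * w > 0" if "\<bar>w\<bar> \<le> t / 4" "t > 0" for t w :: real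
          using that by linarith
        ultimately have "(\<alpha> + 1) / (x * y) + 2 * Re (\<Sum>s\<in>\<Sigma>. T s) > 0" by blast
        then have "h x - h y > 0" unfolding hxy using xy by simp
        then show ?thesis by simp
      qed
      \<comment> \<open>For \<open>L = (X - x) R\<close> one has \<open>L' = R\<close> and
        \<open>L'' = 2 R'\<close> at \<open>x\<close>, while the term with \<open>L\<close> drops
        out. The equation then fixes \<open>R' / R\<close>, the logarithmic derivative of
        \<open>P\<close> plus that of the remaining linear factors.\<close>
      have crit: "h x + (\<Sum>y\<in>B - {x}. 2 / (x - y)) = 0" if xB: "x \<in> B" for x
      proof -
        have x: "x > 0" using xB B by auto
        define p where "p = (\<Prod>y\<in>B - {x}. [:- y, 1:])"
        define R where "R = P * p"
        have LR: "L = [:- x, 1:] * R"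
          unfolding Lq q_def R_def p_def using prod.remove[OF B(1) xB, of "\<lambda>y. [:- y, 1:]"] by (simp add: mult_ac)
        have L1: "poly (pderiv L) x = poly R x" and L2: "poly (pderiv (pderiv L)) x = 2 * poly (pderiv R) x"
          unfolding LR pderiv_mult by (simp_all add: pderiv_pCons pderiv_add pderiv_diff pderiv_smult)
        have p0: "poly p x \<noteq> 0" using B(1) by (auto simp: p_def poly_prod)
        have p1: "poly (pderiv p) x = poly p x * (\<Sum>y\<in>B - {x}. 1 / (x - y))"
          using poly_pderiv_prod_linear[of "B - {x}" x 1] B(1) by (simp add: p_def)
        have "poly (exc_op m n \<alpha> L) x = 0" using L0 by simp
        then have "x * poly S x * (2 * poly (pderiv R) x)
            + ((\<alpha> + 1 - x) * poly S x - 2 * x * poly (pderiv S) x) * poly R x = 0"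
          using B(4) xB unfolding poly_exc_op S_def[symmetric] Let_def L1 L2 by simp
        moreover have "poly R x = poly P x * poly p x"
          "poly (pderiv R) x = poly p x * (poly (pderiv P) x + poly P x * (\<Sum>y\<in>B - {x}. 1 / (x - y)))"
          by (simp_all add: R_def pderiv_mult p1 algebra_simps)
        ultimately have "poly p x * (2 * x * poly S x * (poly (pderiv P) x + poly P x * (\<Sum>y\<in>B - {x}. 1 / (x - y)))
            + ((\<alpha> + 1 - x) * poly S x - 2 * x * poly (pderiv S) x) * poly P x) = 0"
          by (simp add: algebra_simps)
        then have "2 * x * poly S x * (poly (pderiv P) x + poly P x * (\<Sum>y\<in>B - {x}. 1 / (x - y)))
            + ((\<alpha> + 1 - x) * poly S x - 2 * x * poly (pderiv S) x) * poly P x = 0"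
          using p0 by simp
        moreover have "(\<Sum>y\<in>B - {x}. 2 / (x - y)) = 2 * (\<Sum>y\<in>B - {x}. 1 / (x - y))"
          by (simp add: sum_distrib_left)
        moreover have "x * poly S x * poly P x * (h x + 2 * t) =
            2 * x * poly S x * (poly (pderiv P) x + poly P x * t)
            + ((\<alpha> + 1 - x) * poly S x - 2 * x * poly (pderiv S) x) * poly P x" for t
          unfolding h using x Pnz[OF x] Snz[OF x] by (simp add: field_simps)
        ultimately show ?thesis using x Pnz[OF x] Snz[OF x] by (metis mult_eq_0_iff less_irrefl)
      qed
      have "exc_weight m \<alpha> L x > 0" if "x > 0" for x
        using that Pnz[OF that] Snz[OF that] by (simp add: exc_weight_def P_def S_def)
      moreover have "((\<lambda>x. ln (exc_weight m \<alpha> L x)) has_real_derivative h x) (at x)" if "x > 0" for x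
        unfolding h_def using that Pnz[OF that] Snz[OF that] by (intro ln_exc_weight_deriv) (auto simp: P_def S_def)
      moreover have "strict_antimono_on {0<..} h"
        by (rule monotone_onI) (use anti in auto)
      ultimately show "finite (regular_zeros L) \<and> card (regular_zeros L) = n \<and>
          (\<forall>x>0. exc_weight m \<alpha> L x > 0 \<and>
            ((\<lambda>x. ln (exc_weight m \<alpha> L x)) has_real_derivative log_weight_deriv m \<alpha> L x) (at x)) \<and>
          strict_antimono_on {0<..} (log_weight_deriv m \<alpha> L) \<and>
          (\<forall>x\<in>regular_zeros L. log_weight_deriv m \<alpha> L x + (\<Sum>y\<in>regular_zeros L - {x}. 2 / (x - y)) = 0)"
        using crit B unfolding reg h_def by blast
    qed
  qed
qed

section \<open>Energy minimisation\<close>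

text \<open>Since \<open>ln 0 = 0\<close>, the diagonal terms of the double sum vanish.\<close>

definition log_disc :: "(real \<Rightarrow> real) \<Rightarrow> real set \<Rightarrow> real" where
  "log_disc v X = (\<Sum>x\<in>X. ln (v x)) + (\<Sum>x\<in>X. \<Sum>y\<in>X. ln \<bar>x - y\<bar>)"

lemma finite_strict_mono_enum:
  fixes X :: "real set"
  assumes "finite X" "card X = n"
  obtains x where "bij_betw x {..<n} X" "\<And>i j. i < j \<Longrightarrow> j < n \<Longrightarrow> x i < x j"
proof
  show "bij_betw ((!) (sorted_list_of_set X)) {..<n} X"
    using assms by (intro bij_betw_nth) auto
  show "sorted_list_of_set X ! i < sorted_list_of_set X ! j" if "i < j" "j < n" for i j
    using assms that by (intro sorted_wrt_nth_less[of "(<)"]) auto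
qed

text \<open>The tangent of \<open>ln \<bar>t\<bar>\<close> at \<open>b\<close> lies above the graph
  on the side of 0 that contains \<open>b\<close>.\<close>

lemma ln_ratio_le:
  fixes a b :: real
  assumes "a * b > 0"
  shows "ln \<bar>a\<bar> \<le> ln \<bar>b\<bar> + (a - b) / b"
proof -
  have nz: "a \<noteq> 0" "b \<noteq> 0" and pos: "a / b > 0" using assms by (auto simp: zero_less_mult_iff zero_less_divide_iff)
  have "ln \<bar>a\<bar> - ln \<bar>b\<bar> = ln \<bar>a / b\<bar>"
    using nz by (simp add: abs_divide ln_div)
  also have "\<bar>a / b\<bar> = a / b" using pos by (rule abs_of_pos)
  also have "ln (a / b) \<le> a / b - 1" using pos by (rule ln_le_minus_one)
  also have "\<dots> = (a - b) / b" using nz by (simp add: diff_divide_distrib)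
  finally show ?thesis by simp
qed

text \<open>With both sets listed increasingly, corresponding differences have equal signs, so every
  logarithm lies below its tangent at \<open>Z\<close>. The linear terms add up to the derivative of
  the functional at \<open>Z\<close>, which is zero. Strictness comes from the weight at an index
  where the lists differ.\<close>

lemma log_disc_less:
  fixes v h :: "real \<Rightarrow> real"
  assumes deriv: "\<And>x. x > 0 \<Longrightarrow> ((\<lambda>x. ln (v x)) has_real_derivative h x) (at x)"
    and anti: "strict_antimono_on {0<..} h"
    and Z: "finite Z" "Z \<subseteq> {0<..}" "\<And>x. x \<in> Z \<Longrightarrow> h x + (\<Sum>y\<in>Z - {x}. 2 / (x - y)) = 0"
    and X: "finite X" "X \<subseteq> {0<..}" "card X = card Z" "X \<noteq> Z"
  shows "log_disc v X < log_disc v Z"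
proof -
  define n where "n = card Z"
  obtain x where x: "bij_betw x {..<n} X" "\<And>i j. i < j \<Longrightarrow> j < n \<Longrightarrow> x i < x j"
    using finite_strict_mono_enum[OF X(1), of n] X(3) n_def by metis
  obtain z where z: "bij_betw z {..<n} Z" "\<And>i j. i < j \<Longrightarrow> j < n \<Longrightarrow> z i < z j"
    using finite_strict_mono_enum[OF Z(1), of n] n_def by metis
  define d where "d = (\<lambda>i. x i - z i)"
  have pos: "x i > 0" "z i > 0" if "i < n" for i
    using x(1) z(1) X(2) Z(2) that by (auto simp: bij_betw_def subset_iff)
  have Phi: "log_disc v (f ` {..<n}) = (\<Sum>i<n. ln (v (f i))) + (\<Sum>i<n. \<Sum>j<n. ln \<bar>f i - f j\<bar>)"
    if "inj_on f {..<n}" for f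
    using that by (simp add: log_disc_def sum.reindex)
  have PX: "log_disc v X = (\<Sum>i<n. ln (v (x i))) + (\<Sum>i<n. \<Sum>j<n. ln \<bar>x i - x j\<bar>)"
    using Phi[of x] x(1) by (simp add: bij_betw_def)
  have PZ: "log_disc v Z = (\<Sum>i<n. ln (v (z i))) + (\<Sum>i<n. \<Sum>j<n. ln \<bar>z i - z j\<bar>)"
    using Phi[of z] z(1) by (simp add: bij_betw_def)
  have g: "ln (v (x i)) \<le> ln (v (z i)) + h (z i) * d i" if "i < n" for i
    using tangent_strict[OF deriv anti pos[OF that]] by (cases "x i = z i") (auto simp: d_def)
  have "\<exists>i<n. x i \<noteq> z i"
  proof (rule ccontr)
    assume "\<not> ?thesis"
    then have "x ` {..<n} = z ` {..<n}" by (intro image_cong) auto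
    then show False using x(1) z(1) X(4) by (simp add: bij_betw_def)
  qed
  then obtain k where k: "k < n" "x k \<noteq> z k" by blast
  have "ln (v (x k)) < ln (v (z k)) + h (z k) * d k"
    using tangent_strict[OF deriv anti pos[OF k(1)] k(2)] by (simp add: d_def)
  then have sum_g: "(\<Sum>i<n. ln (v (x i))) < (\<Sum>i<n. ln (v (z i)) + h (z i) * d i)"
    using k g by (intro sum_strict_mono_ex1) auto
  have pair: "ln \<bar>x i - x j\<bar> \<le> ln \<bar>z i - z j\<bar> + (d i - d j) / (z i - z j)" if "i < n" "j < n" for i j
  proof (cases "i = j")
    case False
    then have "(x i - x j) * (z i - z j) > 0"
      using that x(2)[of i j] x(2)[of j i] z(2)[of i j] z(2)[of j i]
      by (cases i j rule: linorder_cases) (auto intro: mult_pos_pos mult_neg_neg)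
    from ln_ratio_le[OF this] show ?thesis by (simp add: d_def algebra_simps)
  qed auto
  have sum_pair: "(\<Sum>i<n. \<Sum>j<n. ln \<bar>x i - x j\<bar>)
      \<le> (\<Sum>i<n. \<Sum>j<n. ln \<bar>z i - z j\<bar> + (d i - d j) / (z i - z j))"
    using pair by (intro sum_mono) auto
  \<comment> \<open>Exchanging the indices turns the part with \<open>d j\<close> into the part with
    \<open>d i\<close>, which produces the 2 of the critical equation. The diagonal terms divide by
    zero and so have value 0.\<close>
  have "(\<Sum>i<n. \<Sum>j<n. (d i - d j) / (z i - z j))
      = (\<Sum>i<n. \<Sum>j<n. d i / (z i - z j)) + (\<Sum>i<n. \<Sum>j<n. d j / (z j - z i))"
    by (simp add: sum.distrib[symmetric] diff_divide_distrib)
      (intro sum.cong refl, metis (no_types) add_uminus_conv_diff minus_diff_eq minus_divide_right)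
  also have "(\<Sum>i<n. \<Sum>j<n. d j / (z j - z i)) = (\<Sum>i<n. \<Sum>j<n. d i / (z i - z j))"
    by (rule sum.swap)
  finally have swap: "(\<Sum>i<n. \<Sum>j<n. (d i - d j) / (z i - z j)) = (\<Sum>i<n. d i * (\<Sum>j<n. 2 / (z i - z j)))"
    by (simp add: sum_distrib_left sum.distrib[symmetric] mult.commute)
  have crit: "(\<Sum>j<n. 2 / (z i - z j)) = - h (z i)" if "i < n" for i
  proof -
    have "(\<Sum>j<n. 2 / (z i - z j)) = (\<Sum>y\<in>Z. 2 / (z i - y))"
      using z(1) by (intro sum.reindex_bij_betw)
    also have "\<dots> = (\<Sum>y\<in>Z - {z i}. 2 / (z i - y))"
      using Z(1) by (intro sum.mono_neutral_right) auto
    also have "\<dots> = - h (z i)"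
      using Z(3)[of "z i"] z(1) that by (force simp: bij_betw_def)
    finally show ?thesis .
  qed
  have "log_disc v X < (\<Sum>i<n. ln (v (z i)) + h (z i) * d i)
      + (\<Sum>i<n. \<Sum>j<n. ln \<bar>z i - z j\<bar> + (d i - d j) / (z i - z j))"
    unfolding PX using sum_g sum_pair by (rule add_less_le_mono)
  also have "\<dots> = log_disc v Z + (\<Sum>i<n. h (z i) * d i) + (\<Sum>i<n. d i * (\<Sum>j<n. 2 / (z i - z j)))"
    unfolding PZ by (simp add: sum.distrib swap)
  also have "(\<Sum>i<n. d i * (\<Sum>j<n. 2 / (z i - z j))) = - (\<Sum>i<n. h (z i) * d i)"
    by (simp add: crit sum_negf[symmetric] mult.commute)
  finally show ?thesis by simp
qed

text \<open>Every point occurs in \<open>2 * (n - 1)\<close> ordered pairs, so the exponent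
  \<open>1 / (2 * (n - 1))\<close> restores exactly one \<open>ln (v x)\<close> per point.\<close>

lemma field_energy_eq_log_disc:
  fixes v :: "real \<Rightarrow> real"
  assumes v: "\<And>x. x > 0 \<Longrightarrow> v x > 0" and X: "finite X" "X \<subseteq> {0<..}" "card X = n" and "n \<ge> 2"
  shows "field_energy (\<lambda>x. v x powr (1 / (2 * (real n - 1)))) X = - log_disc v X"
proof -
  define k where "k = (\<lambda>x. ln (v x) / (2 * (real n - 1)))"
  define K where "K = (\<Sum>x\<in>X. k x)"
  have n1: "real n - 1 > 0" using assms by simp
  have vX: "v x > 0" if "x \<in> X" for x using v X that by auto
  have summand: "ln (1 / (\<bar>x - y\<bar> * (v x powr (1 / (2 * (real n - 1)))) * (v y powr (1 / (2 * (real n - 1))))))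
      = - ln \<bar>x - y\<bar> - k x - k y" if "x \<in> X" "y \<in> X - {x}" for x y
    using that vX[of x] vX[of y] by (simp add: ln_div ln_mult ln_powr k_def)
  have "field_energy (\<lambda>x. v x powr (1 / (2 * (real n - 1)))) X
      = (\<Sum>x\<in>X. \<Sum>y\<in>X - {x}. - ln \<bar>x - y\<bar> - k x - k y)"
    unfolding field_energy_def using summand by (intro sum.cong refl) auto
  also have "\<dots> = (\<Sum>x\<in>X. - (\<Sum>y\<in>X. ln \<bar>x - y\<bar>) - (real n - 1) * k x - (K - k x))"
  proof (rule sum.cong[OF refl])
    fix x assume x: "x \<in> X"
    have "(\<Sum>y\<in>X - {x}. ln \<bar>x - y\<bar>) = (\<Sum>y\<in>X. ln \<bar>x - y\<bar>)"
      using X(1) by (intro sum.mono_neutral_left) auto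
    moreover have "(\<Sum>y\<in>X - {x}. k y) = K - k x"
      using X(1) x by (simp add: K_def sum_diff1)
    moreover have "(\<Sum>y\<in>X - {x}. k x) = (real n - 1) * k x"
      using X x assms(5) by (simp add: of_nat_diff)
    ultimately show "(\<Sum>y\<in>X - {x}. - ln \<bar>x - y\<bar> - k x - k y)
        = - (\<Sum>y\<in>X. ln \<bar>x - y\<bar>) - (real n - 1) * k x - (K - k x)"
      by (simp only: sum_subtractf sum_negf)
  qed
  also have "\<dots> = - (\<Sum>x\<in>X. \<Sum>y\<in>X. ln \<bar>x - y\<bar>) - (real n - 1) * K - (real n * K - K)"
    unfolding sum_subtractf sum_negf sum_distrib_left[symmetric] K_def[symmetric] using X(3) by simp
  also have "\<dots> = - (\<Sum>x\<in>X. \<Sum>y\<in>X. ln \<bar>x - y\<bar>) - 2 * (real n - 1) * K"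
    by (simp add: algebra_simps)
  also have "2 * (real n - 1) * K = (\<Sum>x\<in>X. ln (v x))"
    unfolding K_def sum_distrib_left using n1 by (intro sum.cong refl) (simp add: k_def)
  finally show ?thesis by (simp add: log_disc_def)
qed

lemma symmetric_double_sum:
  fixes k :: "nat \<Rightarrow> nat \<Rightarrow> real"
  assumes "\<And>i j. k i j = k j i" "\<And>i. k i i = 0"
  shows "(\<Sum>j\<in>{1..n}. \<Sum>i\<in>{1..n}. k i j) = (\<Sum>j\<in>{1..n}. \<Sum>i\<in>{1..<j}. 2 * k i j)"
proof (induction n)
  case (Suc n)
  have "(\<Sum>i = Suc 0..n. k (Suc n) i) = (\<Sum>i = Suc 0..n. k i (Suc n))"
    by (intro sum.cong refl assms(1))
  then show ?case
    using Suc assms(2)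
    by (simp add: sum.distrib atLeastLessThanSuc_atLeastAtMost sum_distrib_left)
qed simp

section \<open>From sets of points to tuples\<close>

lemma weighted_disc_eq_exp_log_disc:
  assumes v: "\<And>x. x > 0 \<Longrightarrow> v x > 0" and u: "u \<in> {1..n} \<rightarrow> {0<..}" and inj: "inj_on u {1..n}"
  shows "weighted_disc v n u = exp (log_disc v (u ` {1..n}))"
proof -
  have "(\<Prod>j\<in>{1..n}. v (u j)) = (\<Prod>j\<in>{1..n}. exp (ln (v (u j))))"
  proof (intro prod.cong refl)
    fix j assume "j \<in> {1..n}"
    then have "v (u j) > 0" using v u by (auto dest: funcset_mem)
    then show "v (u j) = exp (ln (v (u j)))" by simp
  qed
  also have "\<dots> = exp (\<Sum>j\<in>{1..n}. ln (v (u j)))" by (simp add: exp_sum)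
  finally have 1: "(\<Prod>j\<in>{1..n}. v (u j)) = exp (\<Sum>j\<in>{1..n}. ln (v (u j)))" .
  have "(\<Prod>j\<in>{1..n}. \<Prod>i\<in>{1..<j}. (u i - u j)\<^sup>2) = (\<Prod>j\<in>{1..n}. \<Prod>i\<in>{1..<j}. exp (2 * ln \<bar>u i - u j\<bar>))"
  proof (intro prod.cong refl)
    fix j i assume "j \<in> {1..n}" "i \<in> {1..<j}"
    then have "u i \<noteq> u j" using inj by (auto dest: inj_onD)
    then show "(u i - u j)\<^sup>2 = exp (2 * ln \<bar>u i - u j\<bar>)"
      by (simp add: exp_double)
  qed
  also have "\<dots> = exp (\<Sum>j\<in>{1..n}. \<Sum>i\<in>{1..<j}. 2 * ln \<bar>u i - u j\<bar>)" by (simp add: exp_sum)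
  also have "(\<Sum>j\<in>{1..n}. \<Sum>i\<in>{1..<j}. 2 * ln \<bar>u i - u j\<bar>) = (\<Sum>j\<in>{1..n}. \<Sum>i\<in>{1..n}. ln \<bar>u i - u j\<bar>)"
    by (rule symmetric_double_sum[symmetric]) (auto simp: abs_minus_commute)
  also have "\<dots> = (\<Sum>i\<in>{1..n}. \<Sum>j\<in>{1..n}. ln \<bar>u i - u j\<bar>)" by (rule sum.swap)
  finally show ?thesis
    using inj unfolding weighted_disc_def 1 by (simp add: log_disc_def sum.reindex exp_add)
qed

text \<open>Covers tuples with coinciding points, whose image has fewer than \<open>n\<close>
  elements and is out of reach of \<open>log_disc_less\<close>; the value 0 lies below every
  exponential.\<close>

lemma weighted_disc_not_inj:
  assumes "\<not> inj_on u {1..n}"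
  shows "weighted_disc v n u = 0"
proof -
  obtain a b where "a \<in> {1..n}" "b \<in> {1..n}" "a < b" "u a = u b"
    using assms unfolding inj_on_def by (metis linorder_neqE_nat)
  then have "(\<Prod>i\<in>{1..<b}. (u i - u b)\<^sup>2) = 0"
    by (intro prod_zero) auto
  then have "(\<Prod>j\<in>{1..n}. \<Prod>i\<in>{1..<j}. (u i - u j)\<^sup>2) = 0"
    using \<open>b \<in> {1..n}\<close> by (intro prod_zero) auto
  then show ?thesis by (simp add: weighted_disc_def)
qed

theorem theorem6:
  fixes m :: nat and \<alpha> :: real
  assumes "m \<ge> 1" and "\<alpha> > real m - 1"
  shows "\<exists>n0::nat. \<forall>n\<ge>n0. \<forall>L. exc_laguerre2 m n \<alpha> L \<longrightarrow>
           minimal_energy_sets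
             (\<lambda>x. exc_weight m \<alpha> L x powr (1 / (2 * (real n - 1)))) {0<..} n
             = {regular_zeros L} \<and>
           {u. is_arg_max (weighted_disc (exc_weight m \<alpha> L) n)
                 (\<lambda>u. u \<in> {1..n} \<rightarrow> {0<..}) u}
             = {u \<in> {1..n} \<rightarrow> {0<..}. u ` {1..n} = regular_zeros L}"
proof -
  obtain n1 where n1: "\<And>n L. n \<ge> n1 \<Longrightarrow> exc_laguerre2 m n \<alpha> L \<Longrightarrow>
     finite (regular_zeros L) \<and> card (regular_zeros L) = n \<and>
     (\<forall>x>0. exc_weight m \<alpha> L x > 0 \<and>
       ((\<lambda>x. ln (exc_weight m \<alpha> L x)) has_real_derivative log_weight_deriv m \<alpha> L x) (at x)) \<and>
     strict_antimono_on {0<..} (log_weight_deriv m \<alpha> L) \<and>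
     (\<forall>x\<in>regular_zeros L. log_weight_deriv m \<alpha> L x + (\<Sum>y\<in>regular_zeros L - {x}. 2 / (x - y)) = 0)"
    using exc_weight_critical_log_concave[OF assms(2,1)] unfolding eventually_sequentially by blast
  show ?thesis
  \<comment> \<open>The 2 keeps the exponent \<open>1 / (2 * (real n - 1))\<close> from being a
    division by zero.\<close>
  proof (intro exI[of _ "max n1 2"] allI impI)
    fix n L assume n: "max n1 2 \<le> n" and L: "exc_laguerre2 m n \<alpha> L"
    define v where "v = exc_weight m \<alpha> L"
    define Z where "Z = regular_zeros L"
    have "n \<ge> 2" using n by simp
    have Z: "finite Z" "card Z = n" "Z \<subseteq> {0<..}"
      using n1[OF _ L] n by (auto simp: Z_def regular_zeros_def)
    have v: "v x > 0" if "x > 0" for x using n1[OF _ L] n that by (simp add: v_def)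
    have less: "log_disc v X < log_disc v Z"
      if "finite X" "X \<subseteq> {0<..}" "card X = n" "X \<noteq> Z" for X
      using n1[OF _ L] n Z that unfolding v_def Z_def
      by (intro log_disc_less[where h = "log_weight_deriv m \<alpha> L"]) auto
    have le: "log_disc v X \<le> log_disc v Z"
      if "finite X" "X \<subseteq> {0<..}" "card X = n" for X
      using less[OF that] by (cases "X = Z") auto
    note energy = field_energy_eq_log_disc[OF v _ _ _ \<open>n \<ge> 2\<close>]
    have "minimal_energy_sets (\<lambda>x. v x powr (1 / (2 * (real n - 1)))) {0<..} n = {Z}"
    proof (intro equalityI subsetI)
      fix X assume "X \<in> minimal_energy_sets (\<lambda>x. v x powr (1 / (2 * (real n - 1)))) {0<..} n"
      then have X: "X \<subseteq> {0<..}" "finite X" "card X = n"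
        and "\<not> field_energy (\<lambda>x. v x powr (1 / (2 * (real n - 1)))) Z
          < field_energy (\<lambda>x. v x powr (1 / (2 * (real n - 1)))) X"
        using Z unfolding minimal_energy_sets_def is_arg_min_def by blast+
      then have "\<not> log_disc v X < log_disc v Z"
        using energy Z by simp
      then show "X \<in> {Z}" using less X by blast
    next
      fix X assume "X \<in> {Z}"
      then show "X \<in> minimal_energy_sets (\<lambda>x. v x powr (1 / (2 * (real n - 1)))) {0<..} n"
        using Z energy le by (auto simp: minimal_energy_sets_def is_arg_min_def not_less)
    qed
    moreover have "{u. is_arg_max (weighted_disc v n) (\<lambda>u. u \<in> {1..n} \<rightarrow> {0<..}) u}
        = {u \<in> {1..n} \<rightarrow> {0<..}. u ` {1..n} = Z}"
    proof -
      have inj: "inj_on u {1..n}" if "u ` {1..n} = Z" for u :: "nat \<Rightarrow> real"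
        using that Z by (intro eq_card_imp_inj_on) auto
      have val: "weighted_disc v n u = exp (log_disc v (u ` {1..n}))"
        if "u \<in> {1..n} \<rightarrow> {0<..}" "inj_on u {1..n}" for u
        using weighted_disc_eq_exp_log_disc[OF v that] by simp
      have im: "finite (u ` {1..n})" "u ` {1..n} \<subseteq> {0<..}" "card (u ` {1..n}) = n"
        if "u \<in> {1..n} \<rightarrow> {0<..}" "inj_on u {1..n}" for u :: "nat \<Rightarrow> real"
        using that by (auto simp: card_image)
      have bound: "weighted_disc v n u \<le> exp (log_disc v Z)" if "u \<in> {1..n} \<rightarrow> {0<..}" for u
        using val[OF that] le[OF im[OF that]] weighted_disc_not_inj[of u n v]
        by (cases "inj_on u {1..n}") auto
      have bound_less: "weighted_disc v n u < exp (log_disc v Z)"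
        if "u \<in> {1..n} \<rightarrow> {0<..}" "u ` {1..n} \<noteq> Z" for u
        using val[OF that(1)] less[OF im[OF that(1)] that(2)] weighted_disc_not_inj[of u n v]
        by (cases "inj_on u {1..n}") auto
      \<comment> \<open>An enumeration of \<open>Z\<close> attains the bound, so every maximal tuple
        has to attain it too.\<close>
      obtain u0 where u0: "bij_betw u0 {1..n} Z"
        using Z ex_bij_betw_nat_finite_1[OF Z(1)] by auto
      then have u0': "u0 \<in> {1..n} \<rightarrow> {0<..}" "u0 ` {1..n} = Z" using Z by (auto simp: bij_betw_def)
      have val_Z: "weighted_disc v n u = exp (log_disc v Z)"
        if "u \<in> {1..n} \<rightarrow> {0<..}" "u ` {1..n} = Z" for u
        using val[OF that(1) inj[OF that(2)]] that(2) by simp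
      show ?thesis
      proof (intro equalityI subsetI CollectI)
        fix u assume "u \<in> {u. is_arg_max (weighted_disc v n) (\<lambda>u. u \<in> {1..n} \<rightarrow> {0<..}) u}"
        then have u: "u \<in> {1..n} \<rightarrow> {0<..}" "\<not> weighted_disc v n u < weighted_disc v n u0"
          using u0'(1) by (auto simp: is_arg_max_def)
        then show "u \<in> {1..n} \<rightarrow> {0<..} \<and> u ` {1..n} = Z"
          using bound_less[OF u(1)] val_Z[OF u0'] by auto
      next
        fix u assume "u \<in> {u \<in> {1..n} \<rightarrow> {0<..}. u ` {1..n} = Z}"
        then have u: "u \<in> {1..n} \<rightarrow> {0<..}" "u ` {1..n} = Z" by auto
        then show "is_arg_max (weighted_disc v n) (\<lambda>u. u \<in> {1..n} \<rightarrow> {0<..}) u"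
          using val_Z[OF u] bound by (auto simp: is_arg_max_def not_less)
      qed
    qed
    ultimately show "minimal_energy_sets
             (\<lambda>x. exc_weight m \<alpha> L x powr (1 / (2 * (real n - 1)))) {0<..} n
             = {regular_zeros L} \<and>
           {u. is_arg_max (weighted_disc (exc_weight m \<alpha> L) n)
                 (\<lambda>u. u \<in> {1..n} \<rightarrow> {0<..}) u}
             = {u \<in> {1..n} \<rightarrow> {0<..}. u ` {1..n} = regular_zeros L}"
      unfolding v_def Z_def by blast
  qed
qed

end
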